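(* Let $f:\mathbb{R}^d\to\mathbb{R}$ be $L$-smooth with optimal value $f^*$, let $\mathcal{K}=\mathbb{R}^d$, and suppose the stochastic gradients have bounded variance: $\mathbb{E}_{\xi\sim\mathcal{D}}\|\nabla F(x;\xi)-\nabla f(x)\|^2\le\sigma^2$ for every $x$. Let $\mathcal{A}$ be a $(\delta,\kappa_\delta)$-robust aggregation rule, and run Algorithm 1 (described in the context) for $T$ rounds from $x_1\in\mathbb{R}^d$ with aggregator $\mathcal{A}$ and learning rate $$\eta=\min\left\{\frac{\sqrt{\Delta_1}}{4\sigma\sqrt{L\gamma T\log T}},\ \frac1L\right\},\qquad \gamma:=\kappa_\delta+\frac1m,\quad \Delta_1:=f(x_1)-f^* .$$ Then $$\frac1T\sum_{t=1}^T\mathbb{E}\|\nabla f(x_t)\|^2\le 16\sqrt{\frac{L\Delta_1\sigma^2\gamma\log T}{T}}+\frac{2\left(L\Delta_1+2\sigma^2\gamma\right)}{T}.$$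
   Context: $\|\cdot\|$ is the Euclidean norm, $[m]=\{1,\dots,m\}$, and $\log$ is the base-2 logarithm. In the definition of $\eta$, the first term is read as $+\infty$ if its denominator is zero. Problem: minimize $f(x)=\mathbb{E}_{\xi\sim\mathcal{D}}[F(x;\xi)]$, where $\mathbb{E}_{\xi\sim\mathcal D}[\nabla F(x;\xi)]=\nabla f(x)$. $f$ is $L$-smooth: $f(y)\le f(x)+\nabla f(x)^\top(y-x)+\frac L2\|y-x\|^2$ for all $x,y$. Workers: there are $m$ workers; a fixed set $\mathcal{G}\subseteq[m]$ of honest workers has size $|\mathcal G|=(1-\delta)m$ with $\delta<1/2$; the others are Byzantine. Robust aggregation: $\mathcal{A}:(\mathbb{R}^d)^m\to\mathbb{R}^d$ is $(\delta,\kappa_\delta)$-robust ($\delta<1/2$, $\kappa_\delta\ge0$) if for any vectors $g_1,\dots,g_m$ and any $S\subseteq[m]$ with $|S|=(1-\delta)m$, $\|\mathcal{A}(g_1,\dots,g_m)-\bar g_S\|^2\le\frac{\kappa_\delta}{|S|}\sum_{i\in S}\|g_i-\bar g_S\|^2$, where $\bar g_S=\frac1{|S|}\sum_{i\in S}g_i$. Algorithm 1 (static Byzantine setting). For $t=1,\dots,T$: draw $J_t\sim\mathrm{Geom}(1/2)$ ($\mathbb{P}(J_t=j)=2^{-j}$, $j\ge1$). For $j\in\{0,J_t-1,J_t\}$, each honest worker $i\in\mathcal G$ computes and sends $\bar g_{t,i}^{j}=\frac1{2^j}\sum_{k=1}^{2^j}\nabla F(x_t;\xi_{t,i}^k)$,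 where the $\xi_{t,i}^k$ are fresh i.i.d. samples from $\mathcal D$; each Byzantine worker sends arbitrary vectors in place of $\bar g_{t,i}^0,\bar g_{t,i}^{J_t-1},\bar g_{t,i}^{J_t}$. The server computes $\widehat g_t^{\,j}=\mathcal{A}(\bar g_{t,1}^j,\dots,\bar g_{t,m}^j)$ for $j\in\{0,J_t-1,J_t\}$, sets $g_t=\widehat g_t^{\,0}+2^{J_t}(\widehat g_t^{\,J_t}-\widehat g_t^{\,J_t-1})$ if $J_t\le\lfloor\log T\rfloor$ and $g_t=\widehat g_t^{\,0}$ otherwise, and updates $x_{t+1}=\Pi_{\mathcal K}(x_t-\eta g_t)$, where $\Pi_{\mathcal K}$ is Euclidean projection (the identity when $\mathcal K=\mathbb R^d$).
   Formalization: The Byzantine vectors of each round, one per level j, are assumed independent of the draw J_t (they may depend on the past and on all current honest samples); if they could depend on J_t the bound fails, e.g. for the median of three workers. A is assumed Borel measurable. *)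

theory Defs
  imports "HOL-Probability.Probability"
begin

definition grad :: "('a::real_inner \<Rightarrow> real) \<Rightarrow> 'a \<Rightarrow> 'a" where
  "grad f x = (THE D. GDERIV f x :> D)"

definition L_smooth :: "real \<Rightarrow> ('a::real_inner \<Rightarrow> real) \<Rightarrow> bool" where
  "L_smooth L f \<longleftrightarrow>
     (\<forall>x. f differentiable (at x)) \<and>
     (\<forall>x y. f y \<le> f x + grad f x \<bullet> (y - x) + L / 2 * (norm (y - x))\<^sup>2)"

text \<open>
  The type \<open>'w\<close> is the set \<open>[m]\<close> of workers, so that \<open>m = CARD('w)\<close> and a family
  \<open>(g\<^sub>1, \<dots>, g\<^sub>m)\<close> of vectors has type \<open>(real^'d)^'w\<close>.
\<close>

definition mean_over :: "'w::finite set \<Rightarrow> (real^'d)^'w \<Rightarrow> real^'d" where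
  "mean_over S g = (1 / real (card S)) *\<^sub>R (\<Sum>i\<in>S. g $ i)"

definition robust_aggregator ::
    "real \<Rightarrow> real \<Rightarrow> ((real^'d)^'w::finite \<Rightarrow> real^'d) \<Rightarrow> bool" where
  "robust_aggregator \<delta> \<kappa> A \<longleftrightarrow>
     \<delta> < 1/2 \<and> 0 \<le> \<kappa> \<and>
     (\<forall>g S. real (card S) = (1 - \<delta>) * real CARD('w) \<longrightarrow>
        (norm (A g - mean_over S g))\<^sup>2
          \<le> \<kappa> / real (card S) * (\<Sum>i\<in>S. (norm (g $ i - mean_over S g))\<^sup>2))"

text \<open>
  One round of the algorithm, along a fixed outcome: \<open>z i k\<close> is the \<open>k\<close>-th sample
  of the honest worker \<open>i\<close> (the same samples are used at all levels \<open>j\<close>), and \<open>b i j\<close> is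
  what the Byzantine worker \<open>i\<close> sends in place of its level-\<open>j\<close> minibatch gradient.
\<close>

definition batch_grad ::
    "(real^'d \<Rightarrow> 'z \<Rightarrow> real) \<Rightarrow> (nat \<Rightarrow> 'z) \<Rightarrow> nat \<Rightarrow> real^'d \<Rightarrow> real^'d" where
  "batch_grad F z j x = (1 / 2^j) *\<^sub>R (\<Sum>k=1..2^j. grad (\<lambda>y. F y (z k)) x)"

definition messages ::
    "(real^'d \<Rightarrow> 'z \<Rightarrow> real) \<Rightarrow> 'w::finite set \<Rightarrow> ('w \<Rightarrow> nat \<Rightarrow> 'z) \<Rightarrow> ('w \<Rightarrow> nat \<Rightarrow> real^'d)
      \<Rightarrow> real^'d \<Rightarrow> nat \<Rightarrow> (real^'d)^'w" where
  "messages F G z b x j = (\<chi> i. if i \<in> G then batch_grad F (z i) j x else b i j)"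

definition mlmc_gradient ::
    "(real^'d \<Rightarrow> 'z \<Rightarrow> real) \<Rightarrow> ((real^'d)^'w::finite \<Rightarrow> real^'d) \<Rightarrow> 'w set \<Rightarrow> nat \<Rightarrow> nat
      \<Rightarrow> ('w \<Rightarrow> nat \<Rightarrow> 'z) \<Rightarrow> ('w \<Rightarrow> nat \<Rightarrow> real^'d) \<Rightarrow> real^'d \<Rightarrow> real^'d" where
  "mlmc_gradient F A G T J z b x =
     (let ghat = (\<lambda>j. A (messages F G z b x j)) in
      if int J \<le> \<lfloor>log 2 (real T)\<rfloor>
      then ghat 0 + 2^J *\<^sub>R (ghat J - ghat (J - 1))
      else ghat 0)"

text \<open>
  The randomness of \<open>T\<close> rounds. \<open>\<F> t\<close> is (at least) the information available after
  round \<open>t\<close>; \<open>\<H> t\<close> adds to \<open>\<F> (t - 1)\<close> the honest samples and the Byzantine vectors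
  of round \<open>t\<close>, but not \<open>J t\<close>.

  The Byzantine vectors are otherwise unrestricted: they may depend on the whole past (hence
  on the current iterate), on all honest samples of the current round and on private randomness.
  For every level \<open>j\<close> there is one vector \<open>b t i j\<close> in place of the level-\<open>j\<close>
  minibatch gradient, and the draw of \<open>J t\<close> is independent of these vectors. Without this
  independence, vectors pushing level \<open>J t\<close> one way and level \<open>J t - 1\<close> the
  other way would give the multilevel estimator a bias that does not vanish as \<open>T\<close> grows.
\<close>

locale byzantine_rounds = prob_space M
  for M :: "'o measure" +
  fixes D :: "'z measure"
    and G :: "'w::finite set"
    and T :: nat
    and \<xi> :: "nat \<Rightarrow> 'w \<Rightarrow> nat \<Rightarrow> 'o \<Rightarrow> 'z"
    and b :: "nat \<Rightarrow> 'w \<Rightarrow> nat \<Rightarrow> 'o \<Rightarrow> real^'d"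
    and J :: "nat \<Rightarrow> 'o \<Rightarrow> nat"
    and \<F> \<H> :: "nat \<Rightarrow> 'o measure"
  assumes F_subalgebra: "t \<le> T \<Longrightarrow> subalgebra M (\<F> t)"
    and F_sub_H: "t \<in> {1..T} \<Longrightarrow> subalgebra (\<H> t) (\<F> (t - 1))"
    and H_sub_F: "t \<in> {1..T} \<Longrightarrow> subalgebra (\<F> t) (\<H> t)"
    and sample_measurable:
      "\<lbrakk>t \<in> {1..T}; i \<in> G; 1 \<le> k\<rbrakk> \<Longrightarrow> \<xi> t i k \<in> measurable (\<H> t) D"
    and sample_distr:
      "\<lbrakk>t \<in> {1..T}; i \<in> G; 1 \<le> k\<rbrakk> \<Longrightarrow> distr M D (\<xi> t i k) = D"
    and samples_indep:
      "t \<in> {1..T} \<Longrightarrow> indep_vars (\<lambda>_. D) (\<lambda>(i, k). \<xi> t i k) (G \<times> {1..})"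
    and samples_fresh:
      "t \<in> {1..T} \<Longrightarrow>
         indep_set (sets (\<F> (t - 1)))
           (sets (vimage_algebra (space M) (\<lambda>\<omega>. \<lambda>(i, k)\<in>G \<times> {1..}. \<xi> t i k \<omega>)
                    (PiM (G \<times> {1..}) (\<lambda>_. D))))"
    and byzantine_measurable:
      "\<lbrakk>t \<in> {1..T}; i \<notin> G\<rbrakk> \<Longrightarrow> b t i j \<in> borel_measurable (\<H> t)"
    and level_measurable:
      "t \<in> {1..T} \<Longrightarrow> J t \<in> measurable (\<F> t) (count_space UNIV)"
    and level_geometric:
      "\<lbrakk>t \<in> {1..T}; 1 \<le> j\<rbrakk> \<Longrightarrow> prob {\<omega> \<in> space M. J t \<omega> = j} = 1 / 2^j"
    and level_indep:
      "t \<in> {1..T} \<Longrightarrow>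
         indep_set (sets (\<H> t)) (sets (vimage_algebra (space M) (J t) (count_space UNIV)))"

text \<open>
  The first term of the minimum is read as \<open>+\<infinity>\<close> when its denominator vanishes
  (that is, when \<open>\<sigma> = 0\<close> or \<open>T = 1\<close>).
\<close>

definition learning_rate :: "real \<Rightarrow> real \<Rightarrow> real \<Rightarrow> real \<Rightarrow> nat \<Rightarrow> real" where
  "learning_rate L \<sigma> \<gamma> \<Delta> T =
     (let den = 4 * \<sigma> * sqrt (L * \<gamma> * real T * log 2 (real T)) in
      if den = 0 then 1 / L else min (sqrt \<Delta> / den) (1 / L))"

end

theory Submission
  imports Defs
begin

text \<open>
  The proof only uses total expectations. The server's vector at level \<open>j\<close> is split as
  \<open>ghat j - grad f = (ghat j - gmean j) + (gmean j - grad f)\<close>, where \<open>gmean j\<close> averages the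
  honest messages. Robustness bounds the first part in mean square by \<open>\<kappa> \<sigma>\<^sup>2 / 2^j\<close>; the second is a
  centred weighted sum of independent noise terms, and so is \<open>gmean (j + 1) - gmean j\<close>, because
  the levels share their samples. Independence of \<open>J t\<close> makes the expectation of the level
  correction telescope, so the estimator has the bias of level \<open>\<lfloor>log 2 T\<rfloor>\<close>, while each
  level adds only a constant multiple of \<open>\<gamma> \<sigma>\<^sup>2\<close> to its mean square error. For a step size
  \<open>\<eta> \<le> 1/L\<close> this gives the descent inequality
  \<open>E f(x (t+1)) \<le> E f(x t) - \<eta>/2 E \<parallel>grad f\<parallel>\<^sup>2 + \<eta>/2 bias\<^sup>2 + L \<eta>\<^sup>2/2 error\<close>, which is summed over \<open>t\<close>.
\<close>

subsection \<open>Gradients and measurability\<close>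

text \<open>No moment of the iterates is assumed, so integrability has to be carried along: if
  \<open>f (x t)\<close> is integrable, smoothness and the lower bound of \<open>f\<close> make the
  squared gradient at \<open>x t\<close> integrable, and \<open>f (x (Suc t))\<close> is then
  squeezed between the infimum and an integrable expression. In place of conditional expectations
  the iterate is frozen: since the samples of a round are fresh, their joint law with
  \<open>x t\<close> is a product, and Fubini reduces every claim to a fixed point. The Byzantine
  vectors may depend on the honest samples of the round, so the aggregation error is orthogonal to
  nothing and can only be bounded in mean square; only the honest noise is centred. The weight 2^j,
  squared, meets the probability 2^-j and leaves 2^j, which is absorbed by a mean square gap of
  order 2^-j between neighbouring levels. Each level thus costs the same, and the number of levels
  is the origin of the logarithm in the rate.\<close>

lemma GDERIV_unique: "GDERIV f x :> a \<Longrightarrow> GDERIV f x :> b \<Longrightarrow> a = b"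
  unfolding gderiv_def
  by (metis has_derivative_unique inner_commute vector_eq_ldot)

text \<open>\<open>grad\<close> is a definite description. In finite dimension the derivative, a
  linear functional, is represented by the vector of its values on the basis, so the described
  vector exists; uniqueness is \<open>GDERIV_unique\<close>.\<close>

lemma GDERIV_grad:
  fixes f :: "'a::euclidean_space \<Rightarrow> real"
  assumes "f differentiable (at x)"
  shows "GDERIV f x :> grad f x"
proof -
  obtain f' where f': "(f has_derivative f') (at x)"
    using assms by (auto simp: differentiable_def)
  interpret bounded_linear f' using f' by (rule has_derivative_bounded_linear)
  have "f' h = h \<bullet> (\<Sum>b\<in>Basis. f' b *\<^sub>R b)" for h
  proof -
    have "f' h = f' (\<Sum>b\<in>Basis. (h \<bullet> b) *\<^sub>R b)"
      by (simp add: euclidean_representation)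
    also have "\<dots> = h \<bullet> (\<Sum>b\<in>Basis. f' b *\<^sub>R b)"
      by (simp add: sum scaleR inner_sum_right mult.commute)
    finally show ?thesis .
  qed
  then have "GDERIV f x :> (\<Sum>b\<in>Basis. f' b *\<^sub>R b)"
    using f' unfolding gderiv_def by (metis (no_types, lifting) ext)
  then show ?thesis
    unfolding grad_def by (rule theI) (use \<open>GDERIV f x :> _\<close> GDERIV_unique in blast)
qed

text \<open>Writing directional derivatives as limits along a sequence makes gradients accessible to
  measurability arguments, which pass to countable limits only.\<close>

lemma grad_inner_LIMSEQ:
  fixes f :: "'a::euclidean_space \<Rightarrow> real"
  assumes "f differentiable (at x)"
  shows "(\<lambda>n. (f (x + inverse (real (Suc n)) *\<^sub>R h) - f x) * real (Suc n))
           \<longlonglongrightarrow> grad f x \<bullet> h"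
proof -
  have d: "(f has_derivative (\<lambda>h. h \<bullet> grad f x)) (at x)"
    using GDERIV_grad[OF assms] by (simp add: gderiv_def)
  have "((\<lambda>s. f (x + s *\<^sub>R h)) has_derivative (\<lambda>s. (s *\<^sub>R h) \<bullet> grad f x)) (at 0)"
    by (rule has_derivative_compose[of "\<lambda>s. x + s *\<^sub>R h" "\<lambda>s. s *\<^sub>R h" 0 UNIV f "\<lambda>h. h \<bullet> grad f x"])
       (auto intro!: derivative_eq_intros d)
  then have "((\<lambda>s. f (x + s *\<^sub>R h)) has_real_derivative (h \<bullet> grad f x)) (at 0)"
    by (rule has_derivative_imp_has_field_derivative) simp
  then have "(\<lambda>s. (f (x + s *\<^sub>R h) - f x) / s) \<midarrow>0\<rightarrow> h \<bullet> grad f x"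
    by (simp add: DERIV_def)
  then have "(\<lambda>n. (f (x + inverse (real (Suc n)) *\<^sub>R h) - f x) / inverse (real (Suc n)))
      \<longlonglongrightarrow> h \<bullet> grad f x"
    by (rule filterlim_compose[OF _ filterlim_atI[OF LIMSEQ_inverse_real_of_nat]]) auto
  then show ?thesis by (simp add: inner_commute divide_inverse)
qed

text \<open>Replace \<open>y\<close> by a nearby point of a countable dense set: the approximant
  takes countably many values in its first argument, hence is jointly measurable, and it converges
  by continuity in \<open>y\<close>.\<close>

lemma borel_measurable_caratheodory:
  fixes h :: "'a::{metric_space, second_countable_topology} \<Rightarrow> 'z \<Rightarrow> 'b::metric_space"
  assumes cont: "\<And>z. z \<in> space D \<Longrightarrow> continuous_on UNIV (\<lambda>y. h y z)"
    and meas: "\<And>y. h y \<in> borel_measurable D"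
  shows "(\<lambda>(y, z). h y z) \<in> borel_measurable (borel \<Otimes>\<^sub>M D)"
proof -
  obtain E :: "'a set" where E: "countable E" "\<And>X. open X \<Longrightarrow> X \<noteq> {} \<Longrightarrow> \<exists>d\<in>E. d \<in> X"
    using countable_dense_setE by blast
  define e where "e = from_nat_into E"
  have "E \<noteq> {}" using E(2)[of UNIV] by auto
  then have "range e = E" using E(1) by (simp add: e_def)
  have near: "\<exists>k. dist y (e k) < inverse (real (Suc n))" for y n
    using E(2)[of "ball y (inverse (real (Suc n)))"] \<open>range e = E\<close>
    by (force simp del: of_nat_Suc)
  \<comment> \<open>Taking the least admissible index makes the choice of the nearby point
    measurable in \<open>y\<close>.\<close>
  define q where "q n y = (LEAST k. dist y (e k) < inverse (real (Suc n)))" for n y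
  have q: "dist y (e (q n y)) < inverse (real (Suc n))" for n y
    unfolding q_def using near[of y n] by (rule LeastI_ex)
  have q_meas [measurable]: "q n \<in> borel \<rightarrow>\<^sub>M count_space UNIV" for n
    unfolding q_def by measurable
  have q_lim: "(\<lambda>n. e (q n y)) \<longlonglongrightarrow> y" for y
  proof (rule metric_tendsto_imp_tendsto[OF LIMSEQ_inverse_real_of_nat])
    show "\<forall>\<^sub>F n in sequentially. dist (e (q n y)) y \<le> dist (inverse (real (Suc n))) 0"
      using q[of y] by (auto simp: dist_commute less_imp_le simp del: of_nat_Suc)
  qed
  have lim: "(\<lambda>n. h (e (q n y)) z) \<longlonglongrightarrow> h y z" if "z \<in> space D" for y z
    by (rule continuous_on_tendsto_compose[OF cont[OF that] q_lim]) auto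
  show ?thesis
  proof (rule borel_measurable_LIMSEQ_metric)
    show "(\<lambda>p. h (e (q n (fst p))) (snd p)) \<in> borel_measurable (borel \<Otimes>\<^sub>M D)" for n
      by (rule measurable_compose_countable[where f="\<lambda>k p. h (e k) (snd p)"])
         (use meas in measurable)
    show "(\<lambda>n. h (e (q n (fst p))) (snd p)) \<longlonglongrightarrow> (case p of (y, z) \<Rightarrow> h y z)"
      if "p \<in> space (borel \<Otimes>\<^sub>M D)" for p
      using that lim by (auto simp: space_pair_measure)
  qed
qed

text \<open>Joint measurability is required because iterate and sample are both random. Each
  coordinate of the gradient is a limit of difference quotients, which are jointly measurable by the
  Caratheodory lemma.\<close>

lemma borel_measurable_grad:
  fixes h :: "'a::euclidean_space \<Rightarrow> 'z \<Rightarrow> real"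
  assumes diff: "\<And>y z. z \<in> space D \<Longrightarrow> (\<lambda>u. h u z) differentiable (at y)"
    and meas: "\<And>y. h y \<in> borel_measurable D"
  shows "(\<lambda>(y, z). grad (\<lambda>u. h u z) y) \<in> borel_measurable (borel \<Otimes>\<^sub>M D)"
proof -
  have "continuous_on UNIV (\<lambda>y. h y z)" if "z \<in> space D" for z
    using diff[OF that] by (meson differentiable_imp_continuous_within continuous_at_imp_continuous_on)
  then have [measurable]: "(\<lambda>(y, z). h y z) \<in> borel_measurable (borel \<Otimes>\<^sub>M D)"
    using meas by (rule borel_measurable_caratheodory)
  show ?thesis
  proof (subst borel_measurable_euclidean_space, intro ballI)
    fix v :: 'a
    show "(\<lambda>p. (case p of (y, z) \<Rightarrow> grad (\<lambda>u. h u z) y) \<bullet> v) \<in> borel_measurable (borel \<Otimes>\<^sub>M D)"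
    proof (rule borel_measurable_LIMSEQ_real)
      show "(\<lambda>p. (h (fst p + inverse (real (Suc n)) *\<^sub>R v) (snd p) - h (fst p) (snd p)) * real (Suc n))
          \<in> borel_measurable (borel \<Otimes>\<^sub>M D)" for n
        using measurable_compose[of "\<lambda>p. (fst p + inverse (real (Suc n)) *\<^sub>R v, snd p)"
            "borel \<Otimes>\<^sub>M D" "borel \<Otimes>\<^sub>M D" "\<lambda>(y, z). h y z" borel]
          measurable_compose[of "\<lambda>p. (fst p, snd p)"
            "borel \<Otimes>\<^sub>M D" "borel \<Otimes>\<^sub>M D" "\<lambda>(y, z). h y z" borel]
        by (simp del: of_nat_Suc add: case_prod_beta)
    next
      fix p assume "p \<in> space ((borel :: 'a measure) \<Otimes>\<^sub>M D)"
      then have "(\<lambda>u. h u (snd p)) differentiable (at (fst p))"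
        by (intro diff) (auto simp: space_pair_measure)
      from grad_inner_LIMSEQ[OF this, of v]
      show "(\<lambda>n. (h (fst p + inverse (real (Suc n)) *\<^sub>R v) (snd p) - h (fst p) (snd p)) * real (Suc n))
           \<longlonglongrightarrow> (case p of (y, z) \<Rightarrow> grad (\<lambda>u. h u z) y) \<bullet> v"
        by (simp add: case_prod_beta)
    qed
  qed
qed

lemma borel_measurable_vec:
  fixes g :: "'o \<Rightarrow> 'a::euclidean_space ^ 'n"
  assumes [measurable]: "\<And>i. (\<lambda>\<omega>. g \<omega> $ i) \<in> borel_measurable M"
  shows "g \<in> borel_measurable M"
proof -
  have "linear (axis i :: 'a \<Rightarrow> 'a ^ 'n)" for i
    by (rule linearI) (simp_all add: vec_eq_iff axis_def)
  then have [measurable]: "(axis i :: 'a \<Rightarrow> 'a ^ 'n) \<in> borel_measurable borel" for i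
    by (intro borel_measurable_continuous_onI linear_continuous_on)
       (simp add: linear_conv_bounded_linear)
  have "(\<lambda>\<omega>. \<Sum>i\<in>UNIV. axis i (g \<omega> $ i)) \<in> borel_measurable M"
    by measurable
  moreover have "g = (\<lambda>\<omega>. \<Sum>i\<in>UNIV. axis i (g \<omega> $ i))"
    by (simp add: fun_eq_iff vec_eq_iff axis_def)
  ultimately show ?thesis by (rule back_subst[of "\<lambda>h. h \<in> borel_measurable M", OF _ sym])
qed

subsection \<open>Elementary inequalities\<close>

text \<open>A gradient step of length 1/L cannot go below the infimum. This turns integrability of
  function values into integrability of squared gradients.\<close>

lemma L_smooth_grad_bound:
  fixes f :: "'a::euclidean_space \<Rightarrow> real"
  assumes "0 < L" "L_smooth L f" "bdd_below (range f)"
  shows "(norm (grad f x))\<^sup>2 \<le> 2 * L * (f x - (INF y. f y))"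
proof -
  let ?y = "x - (1 / L) *\<^sub>R grad f x"
  have "(INF y. f y) \<le> f ?y"
    using assms(3) by (intro cINF_lower) auto
  also have "\<dots> \<le> f x + grad f x \<bullet> (?y - x) + L / 2 * (norm (?y - x))\<^sup>2"
    using assms(2) unfolding L_smooth_def by blast
  also have "grad f x \<bullet> (?y - x) = - ((norm (grad f x))\<^sup>2 / L)"
    by (simp add: power2_norm_eq_inner)
  also have "L / 2 * (norm (?y - x))\<^sup>2 = (norm (grad f x))\<^sup>2 / (2 * L)"
    using assms(1) by (simp add: power_mult_distrib power_divide power2_eq_square)
  finally show ?thesis using assms(1) by (simp add: field_simps)
qed

lemma abs_inner_le_half_squares:
  "\<bar>u \<bullet> v\<bar> \<le> ((norm u)\<^sup>2 + (norm (v::'a::real_inner))\<^sup>2) / 2"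
proof -
  have "2 * (norm u * norm v) \<le> (norm u)\<^sup>2 + (norm v)\<^sup>2"
    using sum_squares_bound[of "norm u" "norm v"] by simp
  then show ?thesis using Cauchy_Schwarz_ineq2[of u v] by simp
qed

lemma norm_add_squared_le:
  "(norm (u + v))\<^sup>2 \<le> 2 * (norm u)\<^sup>2 + 2 * (norm (v::'a::real_inner))\<^sup>2"
  using abs_inner_le_half_squares[of u v]
  by (simp add: power2_norm_eq_inner inner_add_left inner_add_right inner_commute)

lemma norm_add3_squared_le:
  "(norm (u + v + w))\<^sup>2 \<le> 3 * (norm u)\<^sup>2 + 3 * (norm v)\<^sup>2 + 3 * (norm (w::'a::real_inner))\<^sup>2"
  using abs_inner_le_half_squares[of u v] abs_inner_le_half_squares[of u w]
    abs_inner_le_half_squares[of v w]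
  by (simp add: power2_norm_eq_inner inner_add_left inner_add_right inner_commute)

text \<open>Here \<open>a\<close> stands for the gradient and \<open>b\<close> for the error of the
  estimator. The cross term stays separate, since its expectation sees only the bias.\<close>

lemma quadratic_step:
  fixes a b :: "'a::real_inner"
  shows "a \<bullet> (- \<eta> *\<^sub>R (a + b)) + L / 2 * (norm (- \<eta> *\<^sub>R (a + b)))\<^sup>2
    = - (\<eta> - L * \<eta>\<^sup>2 / 2) * (norm a)\<^sup>2 - \<eta> * (1 - L * \<eta>) * (a \<bullet> b)
      + L * \<eta>\<^sup>2 / 2 * (norm b)\<^sup>2"
proof -
  have n: "(norm (- \<eta> *\<^sub>R (a + b)))\<^sup>2 = \<eta>\<^sup>2 * ((norm a)\<^sup>2 + 2 * (a \<bullet> b) + (norm b)\<^sup>2)"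
    unfolding norm_scaleR power_mult_distrib
    by (simp add: power2_norm_eq_inner inner_add_left inner_add_right inner_commute)
  have i: "a \<bullet> (- \<eta> *\<^sub>R (a + b)) = - \<eta> * ((norm a)\<^sup>2 + a \<bullet> b)"
    unfolding inner_scaleR_right by (simp add: inner_add_right power2_norm_eq_inner)
  show ?thesis unfolding n i by (simp add: algebra_simps power2_eq_square)
qed

text \<open>\<open>Q\<close>, \<open>I\<close>, \<open>W\<close> stand for the expectations of the
  squared gradient, of the cross term and of the squared error, and \<open>e\<close> for the squared
  bias. Replacing \<open>-I\<close> by \<open>(Q + e) / 2\<close> is possible since L\<eta> \<le> 1,
  and the coefficients of \<open>Q\<close> then add up to exactly -\<eta>/2.\<close>

lemma descent_arith:
  fixes L \<eta> e Q I W V E :: real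
  assumes "0 \<le> \<eta>" "0 \<le> L" "L * \<eta> \<le> 1" "0 \<le> e" "- 2 * I \<le> Q + e" "W \<le> V"
  shows "E - (\<eta> - L * \<eta>\<^sup>2 / 2) * Q - \<eta> * (1 - L * \<eta>) * I + L * \<eta>\<^sup>2 / 2 * W
    \<le> E - \<eta> / 2 * Q + \<eta> / 2 * e + L * \<eta>\<^sup>2 / 2 * V"
proof -
  have "\<eta> * (1 - L * \<eta>) * (- I) \<le> \<eta> * (1 - L * \<eta>) * (Q / 2 + e / 2)"
    using assms by (intro mult_left_mono) auto
  moreover have "\<eta> * (1 - L * \<eta>) * e \<le> \<eta> * 1 * e"
    using assms by (intro mult_right_mono mult_left_mono) auto
  moreover have "L * \<eta>\<^sup>2 / 2 * W \<le> L * \<eta>\<^sup>2 / 2 * V"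
    using assms by (intro mult_left_mono) auto
  ultimately show ?thesis by (simp add: field_simps power2_eq_square)
qed

text \<open>After division by \<eta>, the initial gap contributes at most 8TR and the noise at most
  8TR, where \<open>R\<close> is the square root in the rate. The key identities are rd = 4TR and
  its consequence for Rd, with r/d the first candidate for \<eta>.\<close>

lemma learning_rate_tradeoff:
  fixes L \<sigma> \<gamma> \<Delta> T l \<eta> S :: real
  assumes pos: "0 < L" "0 < \<sigma>" "0 < \<gamma>" "0 < \<Delta>" "0 < T" and l: "1 \<le> l"
    and \<eta>: "\<eta> = min (sqrt \<Delta> / (4 * \<sigma> * sqrt (L * \<gamma> * T * l))) (1 / L)"
    and S: "\<eta> * S \<le> 2 * \<Delta> + T * (\<eta> * (2 * \<gamma> * \<sigma>\<^sup>2 / T) + L * \<eta>\<^sup>2 * ((8 + 18 * l) * \<gamma> * \<sigma>\<^sup>2))"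
  shows "S / T \<le> 16 * sqrt (L * \<Delta> * \<sigma>\<^sup>2 * \<gamma> * l / T) + 2 * (L * \<Delta> + 2 * \<sigma>\<^sup>2 * \<gamma>) / T"
proof -
  define R where "R = sqrt (L * \<Delta> * \<sigma>\<^sup>2 * \<gamma> * l / T)"
  define r where "r = sqrt \<Delta>"
  define d where "d = 4 * \<sigma> * sqrt (L * \<gamma> * T * l)"
  have r: "0 < r" "\<Delta> = r\<^sup>2" using pos by (auto simp: r_def)
  have d: "0 < d" using pos l by (simp add: d_def)
  have \<eta>': "\<eta> = min (r / d) (1 / L)" using \<eta> by (simp add: r_def d_def)
  then have \<eta>_pos: "0 < \<eta>" using r d pos by simp
  have R: "0 \<le> R" using pos l by (simp add: R_def)
  have TR2: "T * R\<^sup>2 = L * r\<^sup>2 * \<sigma>\<^sup>2 * \<gamma> * l"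
    using pos l r by (simp add: R_def)
  have "(r * d)\<^sup>2 = (4 * T * R)\<^sup>2"
    using pos l TR2 r by (simp add: d_def power_mult_distrib power2_eq_square[of T] algebra_simps)
  then have rd: "r * d = 4 * T * R"
    using r d pos R by (simp add: power2_eq_iff_nonneg)
  have "r * (R * d) = r * (4 * L * r * \<sigma>\<^sup>2 * \<gamma> * l)"
    using rd TR2 by (simp add: power2_eq_square algebra_simps)
  then have Rd: "R * d = 4 * L * r * \<sigma>\<^sup>2 * \<gamma> * l" using r by simp
  \<comment> \<open>The reciprocal of a minimum is the maximum of the reciprocals, hence at most
    their sum.\<close>
  have "1 / \<eta> \<le> d / r + L"
    unfolding \<eta>' using r d pos by (cases "r / d \<le> 1 / L") (auto simp: min_def)
  then have "2 * \<Delta> * (1 / \<eta>) \<le> 2 * \<Delta> * (d / r + L)"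
    using pos by (intro mult_left_mono) auto
  also have "\<dots> = 2 * (r * d) + 2 * L * \<Delta>"
    using r by (simp add: power2_eq_square field_simps)
  finally have first: "2 * \<Delta> / \<eta> \<le> 8 * T * R + 2 * L * \<Delta>"
    using rd by simp
  \<comment> \<open>Since l \<ge> 1, 8 + 18l \<le> 26l; the factor 4 in the identity for
    \<open>R * d\<close> turns 26 into 13/2, which is below 8.\<close>
  have "L * \<eta> * ((8 + 18 * l) * \<gamma> * \<sigma>\<^sup>2) \<le> L * (r / d) * ((26 * l) * \<gamma> * \<sigma>\<^sup>2)"
    using pos l r d \<eta>_pos by (intro mult_mono) (auto simp: \<eta>')
  also have "\<dots> = 13 / 2 * (R * d) / d"
    unfolding Rd by (simp add: field_simps)
  also have "\<dots> \<le> 8 * R" using d R by simp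
  finally have second: "L * \<eta> * ((8 + 18 * l) * \<gamma> * \<sigma>\<^sup>2) \<le> 8 * R" .
  have "S \<le> (2 * \<Delta> + T * (\<eta> * (2 * \<gamma> * \<sigma>\<^sup>2 / T) + L * \<eta>\<^sup>2 * ((8 + 18 * l) * \<gamma> * \<sigma>\<^sup>2))) / \<eta>"
    using S \<eta>_pos by (simp add: pos_le_divide_eq mult.commute)
  also have "\<dots> = 2 * \<Delta> / \<eta> + 2 * \<gamma> * \<sigma>\<^sup>2 + T * (L * \<eta> * ((8 + 18 * l) * \<gamma> * \<sigma>\<^sup>2))"
    using \<eta>_pos pos by (simp add: field_simps power2_eq_square)
  also have "\<dots> \<le> 8 * T * R + 2 * L * \<Delta> + 2 * \<gamma> * \<sigma>\<^sup>2 + T * (8 * R)"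
    using first second pos by (intro add_mono mult_left_mono) auto
  also have "\<dots> \<le> T * (16 * R + 2 * (L * \<Delta> + 2 * \<sigma>\<^sup>2 * \<gamma>) / T)"
    using pos by (simp add: field_simps)
  finally show ?thesis
    using pos by (simp add: R_def pos_divide_le_eq mult.commute)
qed

lemma integrable_inner_of_squares:
  fixes u v :: "'o \<Rightarrow> 'a::euclidean_space"
  assumes [measurable]: "u \<in> borel_measurable M" "v \<in> borel_measurable M"
    and "integrable M (\<lambda>\<omega>. (norm (u \<omega>))\<^sup>2)" "integrable M (\<lambda>\<omega>. (norm (v \<omega>))\<^sup>2)"
  shows "integrable M (\<lambda>\<omega>. u \<omega> \<bullet> v \<omega>)"
  by (rule Bochner_Integration.integrable_bound[where f="\<lambda>\<omega>. ((norm (u \<omega>))\<^sup>2 + (norm (v \<omega>))\<^sup>2) / 2"])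
     (use assms abs_inner_le_half_squares in \<open>auto intro!: AE_I2\<close>)

lemma integrable_of_nonneg_le:
  fixes u v :: "'o \<Rightarrow> real"
  assumes "integrable M v" "u \<in> borel_measurable M"
    and "\<And>\<omega>. \<omega> \<in> space M \<Longrightarrow> 0 \<le> u \<omega>" "\<And>\<omega>. \<omega> \<in> space M \<Longrightarrow> u \<omega> \<le> v \<omega>"
  shows "integrable M u"
  using assms(1,2)
proof (rule Bochner_Integration.integrable_bound, intro AE_I2)
  fix \<omega> assume "\<omega> \<in> space M"
  from assms(3,4)[OF this] show "norm (u \<omega>) \<le> norm (v \<omega>)" by simp
qed

subsection \<open>Orthogonality and independence\<close>

text \<open>Pythagoras: the off-diagonal terms of the expanded square integrate to zero. General
  weights cover both averages and the signed differences of neighbouring levels.\<close>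

lemma weighted_sum_orthogonal:
  fixes Y :: "'i \<Rightarrow> 'o \<Rightarrow> 'a::euclidean_space"
  assumes "finite P"
    and [measurable]: "\<And>p. p \<in> P \<Longrightarrow> Y p \<in> borel_measurable M"
    and sq: "\<And>p. p \<in> P \<Longrightarrow> integrable M (\<lambda>\<omega>. (norm (Y p \<omega>))\<^sup>2)"
    and le: "\<And>p. p \<in> P \<Longrightarrow> (\<integral>\<omega>. (norm (Y p \<omega>))\<^sup>2 \<partial>M) \<le> s"
    and orth: "\<And>p q. p \<in> P \<Longrightarrow> q \<in> P \<Longrightarrow> p \<noteq> q \<Longrightarrow> (\<integral>\<omega>. Y p \<omega> \<bullet> Y q \<omega> \<partial>M) = 0"
  shows "integrable M (\<lambda>\<omega>. (norm (\<Sum>p\<in>P. c p *\<^sub>R Y p \<omega>))\<^sup>2)"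
    and "(\<integral>\<omega>. (norm (\<Sum>p\<in>P. c p *\<^sub>R Y p \<omega>))\<^sup>2 \<partial>M) \<le> s * (\<Sum>p\<in>P. (c p)\<^sup>2)"
proof -
  have int: "integrable M (\<lambda>\<omega>. Y p \<omega> \<bullet> Y q \<omega>)" if "p \<in> P" "q \<in> P" for p q
    using that by (intro integrable_inner_of_squares sq) auto
  have eq: "(norm (\<Sum>p\<in>P. c p *\<^sub>R Y p \<omega>))\<^sup>2
      = (\<Sum>p\<in>P. \<Sum>q\<in>P. c p * c q * (Y p \<omega> \<bullet> Y q \<omega>))" for \<omega>
    unfolding power2_norm_eq_inner inner_sum_left inner_sum_right
    by (intro sum.cong refl) (simp add: inner_commute)
  show "integrable M (\<lambda>\<omega>. (norm (\<Sum>p\<in>P. c p *\<^sub>R Y p \<omega>))\<^sup>2)"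
    unfolding eq using int by auto
  have "(\<integral>\<omega>. (norm (\<Sum>p\<in>P. c p *\<^sub>R Y p \<omega>))\<^sup>2 \<partial>M)
      = (\<Sum>p\<in>P. \<Sum>q\<in>P. c p * c q * (\<integral>\<omega>. Y p \<omega> \<bullet> Y q \<omega> \<partial>M))"
    unfolding eq using int by (simp add: Bochner_Integration.integral_sum)
  also have "\<dots> = (\<Sum>p\<in>P. (c p)\<^sup>2 * (\<integral>\<omega>. (norm (Y p \<omega>))\<^sup>2 \<partial>M))"
  proof (rule sum.cong[OF refl])
    fix p assume p: "p \<in> P"
    have "(\<Sum>q\<in>P. c p * c q * (\<integral>\<omega>. Y p \<omega> \<bullet> Y q \<omega> \<partial>M))
        = (\<Sum>q\<in>P. if q = p then c p * c q * (\<integral>\<omega>. Y p \<omega> \<bullet> Y q \<omega> \<partial>M) else 0)"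
      using orth[OF p] by (intro sum.cong) auto
    then show "(\<Sum>q\<in>P. c p * c q * (\<integral>\<omega>. Y p \<omega> \<bullet> Y q \<omega> \<partial>M))
        = (c p)\<^sup>2 * (\<integral>\<omega>. (norm (Y p \<omega>))\<^sup>2 \<partial>M)"
      using p \<open>finite P\<close> by (simp add: power2_norm_eq_inner power2_eq_square[of "c p"])
  qed
  also have "\<dots> \<le> (\<Sum>p\<in>P. (c p)\<^sup>2 * s)"
    using le by (intro sum_mono mult_left_mono) auto
  finally show "(\<integral>\<omega>. (norm (\<Sum>p\<in>P. c p *\<^sub>R Y p \<omega>))\<^sup>2 \<partial>M) \<le> s * (\<Sum>p\<in>P. (c p)\<^sup>2)"
    by (simp add: sum_distrib_left mult.commute)
qed

lemma (in prob_space) subalgebra_vimage_algebra: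
  assumes "Z \<in> M \<rightarrow>\<^sub>M N"
  shows "subalgebra M (vimage_algebra (space M) Z N)"
proof -
  have "sets (vimage_algebra (space M) Z N) \<subseteq> sets M"
    using assms measurable_space[OF assms]
    by (auto simp: sets_vimage_algebra2 intro: measurable_sets)
  then show ?thesis by (simp add: subalgebra_def)
qed

text \<open>
  \<^const>\<open>prob_space.indep_var\<close> forces both random variables to have the same type, so
  independence of an iterate and a family of samples is expressed by their joint distribution.
\<close>
lemma (in prob_space) distr_pair_of_indep_set:
  assumes ind: "indep_set (sets F) (sets H)"
    and F: "subalgebra M F" and X: "X \<in> F \<rightarrow>\<^sub>M S"
    and H: "subalgebra M H" and Z: "Z \<in> H \<rightarrow>\<^sub>M R"
  shows "distr M (S \<Otimes>\<^sub>M R) (\<lambda>\<omega>. (X \<omega>, Z \<omega>)) = distr M S X \<Otimes>\<^sub>M distr M R Z"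
proof -
  have [simp]: "space F = space M" "space H = space M"
    using F H by (auto simp: subalgebra_def)
  have [measurable]: "X \<in> M \<rightarrow>\<^sub>M S" "Z \<in> M \<rightarrow>\<^sub>M R"
    using F X H Z by (auto intro: measurable_from_subalg)
  interpret X: prob_space "distr M S X" by (rule prob_space_distr) simp
  interpret Z: prob_space "distr M R Z" by (rule prob_space_distr) simp
  show ?thesis
  proof (rule pair_measure_eqI[symmetric])
    show "sigma_finite_measure (distr M S X)" "sigma_finite_measure (distr M R Z)" ..
    show "sets (distr M S X \<Otimes>\<^sub>M distr M R Z) = sets (distr M (S \<Otimes>\<^sub>M R) (\<lambda>\<omega>. (X \<omega>, Z \<omega>)))"
      by (simp cong: sets_pair_measure_cong)
    fix A B assume "A \<in> sets (distr M S X)" "B \<in> sets (distr M R Z)"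
    then have A[measurable]: "A \<in> sets S" and B[measurable]: "B \<in> sets R" by auto
    have "prob ((X -` A \<inter> space M) \<inter> (Z -` B \<inter> space M))
        = prob (X -` A \<inter> space M) * prob (Z -` B \<inter> space M)"
      using measurable_sets[OF X A] measurable_sets[OF Z B] by (intro indep_setD[OF ind]) auto
    then show "emeasure (distr M S X) A * emeasure (distr M R Z) B
        = emeasure (distr M (S \<Otimes>\<^sub>M R) (\<lambda>\<omega>. (X \<omega>, Z \<omega>))) (A \<times> B)"
      by (simp add: emeasure_distr emeasure_eq_measure ennreal_mult'[symmetric] vimage_def
          Int_def conj_comms conj_left_commute)
  qed
qed

lemma (in prob_space) indep_var_of_indep_set:
  assumes ind: "indep_set (sets F) (sets H)"
    and F: "subalgebra M F" and X: "X \<in> F \<rightarrow>\<^sub>M S"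
    and H: "subalgebra M H" and Z: "Z \<in> H \<rightarrow>\<^sub>M R"
  shows "indep_var S X R Z"
  using F X H Z by (simp add: indep_var_distribution_eq measurable_from_subalg
      distr_pair_of_indep_set[OF ind F X H Z])

text \<open>Tonelli with the first variable frozen. The nonnegative form presupposes no
  integrability, so it can be used to establish it.\<close>

lemma (in prob_space) nn_integral_indep_le:
  assumes [measurable]: "X \<in> M \<rightarrow>\<^sub>M S" "Z \<in> M \<rightarrow>\<^sub>M R"
    and ind: "distr M (S \<Otimes>\<^sub>M R) (\<lambda>\<omega>. (X \<omega>, Z \<omega>)) = distr M S X \<Otimes>\<^sub>M distr M R Z"
    and h[measurable]: "h \<in> borel_measurable (S \<Otimes>\<^sub>M R)"
    and le: "\<And>y. y \<in> space S \<Longrightarrow> (\<integral>\<^sup>+\<omega>. h (y, Z \<omega>) \<partial>M) \<le> C"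
  shows "(\<integral>\<^sup>+\<omega>. h (X \<omega>, Z \<omega>) \<partial>M) \<le> C"
proof -
  interpret X: prob_space "distr M S X" by (rule prob_space_distr) simp
  interpret Z: prob_space "distr M R Z" by (rule prob_space_distr) simp
  have "(\<integral>\<^sup>+\<omega>. h (X \<omega>, Z \<omega>) \<partial>M) = (\<integral>\<^sup>+p. h p \<partial>distr M (S \<Otimes>\<^sub>M R) (\<lambda>\<omega>. (X \<omega>, Z \<omega>)))"
    by (simp add: nn_integral_distr)
  also have "\<dots> = (\<integral>\<^sup>+y. \<integral>\<^sup>+z. h (y, z) \<partial>distr M R Z \<partial>distr M S X)"
    unfolding ind by (rule Z.nn_integral_fst[symmetric]) simp
  also have "\<dots> \<le> (\<integral>\<^sup>+y. C \<partial>distr M S X)"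
    using le by (intro nn_integral_mono) (simp add: nn_integral_distr)
  also have "\<dots> = C" using X.emeasure_space_1 by simp
  finally show ?thesis .
qed

text \<open>The signed counterpart, by Fubini; here integrability of the composite has to be known
  beforehand.\<close>

lemma (in prob_space) integral_indep_eq_0:
  fixes h :: "_ \<Rightarrow> real"
  assumes [measurable]: "X \<in> M \<rightarrow>\<^sub>M S" "Z \<in> M \<rightarrow>\<^sub>M R"
    and ind: "distr M (S \<Otimes>\<^sub>M R) (\<lambda>\<omega>. (X \<omega>, Z \<omega>)) = distr M S X \<Otimes>\<^sub>M distr M R Z"
    and h[measurable]: "h \<in> borel_measurable (S \<Otimes>\<^sub>M R)"
    and int: "integrable M (\<lambda>\<omega>. h (X \<omega>, Z \<omega>))"
    and z: "\<And>y. y \<in> space S \<Longrightarrow> (\<integral>\<omega>. h (y, Z \<omega>) \<partial>M) = 0"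
  shows "(\<integral>\<omega>. h (X \<omega>, Z \<omega>) \<partial>M) = 0"
proof -
  interpret X: prob_space "distr M S X" by (rule prob_space_distr) simp
  interpret Z: prob_space "distr M R Z" by (rule prob_space_distr) simp
  interpret P: pair_sigma_finite "distr M S X" "distr M R Z" ..
  have "integrable (distr M S X \<Otimes>\<^sub>M distr M R Z) h"
    unfolding ind[symmetric] using int by (simp add: integrable_distr_eq)
  then have "(\<integral>y. \<integral>z. h (y, z) \<partial>distr M R Z \<partial>distr M S X)
      = (\<integral>p. h p \<partial>(distr M S X \<Otimes>\<^sub>M distr M R Z))"
    by (rule P.integral_fst')
  also have "\<dots> = (\<integral>\<omega>. h (X \<omega>, Z \<omega>) \<partial>M)"
    unfolding ind[symmetric] by (simp add: integral_distr)
  finally have "(\<integral>\<omega>. h (X \<omega>, Z \<omega>) \<partial>M) = (\<integral>y. \<integral>z. h (y, z) \<partial>distr M R Z \<partial>distr M S X)" ..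
  also have "\<dots> = (\<integral>y. 0 \<partial>distr M S X)"
    using z by (intro Bochner_Integration.integral_cong) (auto simp: integral_distr)
  finally show ?thesis by simp
qed

text \<open>Independence of the level factors the expectation. The probability that comes out
  cancels the weight of that level in the estimator.\<close>

lemma (in prob_space) integral_mult_indicator_indep:
  fixes Y :: "_ \<Rightarrow> real"
  assumes ind: "indep_set (sets F) (sets (vimage_algebra (space M) J (count_space UNIV)))"
    and F: "subalgebra M F" and Y: "Y \<in> borel_measurable F" and int: "integrable M Y"
    and J: "J \<in> M \<rightarrow>\<^sub>M count_space UNIV"
  shows "integrable M (\<lambda>\<omega>. Y \<omega> * of_bool (J \<omega> = j))"
    and "(\<integral>\<omega>. Y \<omega> * of_bool (J \<omega> = j) \<partial>M)
           = (\<integral>\<omega>. Y \<omega> \<partial>M) * prob {\<omega> \<in> space M. J \<omega> = j}"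
proof -
  let ?I = "\<lambda>\<omega>. of_bool (J \<omega> = j) :: real"
  have "J \<in> vimage_algebra (space M) J (count_space UNIV) \<rightarrow>\<^sub>M count_space UNIV"
    by (rule measurable_vimage_algebra1) simp
  then have "?I \<in> borel_measurable (vimage_algebra (space M) J (count_space UNIV))"
    by (rule measurable_compose) simp
  then have ind: "indep_var borel Y borel ?I"
    by (rule indep_var_of_indep_set[OF ind F Y subalgebra_vimage_algebra[OF J]])
  have "?I \<in> borel_measurable M"
    using J by (rule measurable_compose) simp
  then have int_J: "integrable M ?I"
    by (intro integrable_const_bound[of _ 1]) auto
  show "integrable M (\<lambda>\<omega>. Y \<omega> * of_bool (J \<omega> = j))"
    by (rule indep_var_integrable[OF ind int int_J])
  have "(\<integral>\<omega>. of_bool (J \<omega> = j) \<partial>M) = (\<integral>\<omega>. indicator {\<omega> \<in> space M. J \<omega> = j} \<omega> \<partial>M :: real)"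
    by (intro Bochner_Integration.integral_cong) (auto simp: indicator_def)
  also have "\<dots> = prob {\<omega> \<in> space M. J \<omega> = j}"
    using J by simp
  finally show "(\<integral>\<omega>. Y \<omega> * of_bool (J \<omega> = j) \<partial>M)
           = (\<integral>\<omega>. Y \<omega> \<partial>M) * prob {\<omega> \<in> space M. J \<omega> = j}"
    using indep_var_lebesgue_integral[OF ind int int_J] by simp
qed

subsection \<open>The noise of the stochastic gradients\<close>

text \<open>The step size is only required to lie in [0, 1/L], which is all that the descent
  argument uses; its actual value enters in \<open>average_bound\<close>. The update is stated
  without projection.\<close>

locale byzantine_sgd =
  byzantine_rounds M D G T \<xi> b J \<F> \<H> + D: prob_space D
  for M :: "'o measure" and D :: "'z measure" and G :: "'w::finite set" and T \<xi>
    and b :: "nat \<Rightarrow> 'w \<Rightarrow> nat \<Rightarrow> 'o \<Rightarrow> real^'d" and J \<F> \<H> +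
  fixes F :: "real^'d \<Rightarrow> 'z \<Rightarrow> real"
    and f :: "real^'d \<Rightarrow> real"
    and A :: "(real^'d)^'w \<Rightarrow> real^'d"
    and x :: "nat \<Rightarrow> 'o \<Rightarrow> real^'d" and x1 :: "real^'d"
    and L \<sigma> \<delta> \<kappa> \<eta> :: real
  assumes F_diff: "\<And>y z. z \<in> space D \<Longrightarrow> (\<lambda>u. F u z) differentiable (at y)"
    and F_integrable: "\<And>y. integrable D (F y)"
    and L_pos: "0 < L" and smooth: "L_smooth L f" and f_bdd: "bdd_below (range f)"
    and gradF_integrable: "\<And>y. integrable D (\<lambda>z. grad (\<lambda>u. F u z) y)"
    and gradF_mean: "\<And>y. (\<integral>z. grad (\<lambda>u. F u z) y \<partial>D) = grad f y"
    and var_integrable: "\<And>y. integrable D (\<lambda>z. (norm (grad (\<lambda>u. F u z) y - grad f y))\<^sup>2)"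
    and var_le: "\<And>y. (\<integral>z. (norm (grad (\<lambda>u. F u z) y - grad f y))\<^sup>2 \<partial>D) \<le> \<sigma>\<^sup>2"
    and card_G: "real (card G) = (1 - \<delta>) * real CARD('w)"
    and robust: "robust_aggregator \<delta> \<kappa> A" and A_borel [measurable]: "A \<in> borel_measurable borel"
    and T_ge_1: "1 \<le> T"
    and eta_nonneg: "0 \<le> \<eta>" and eta_le: "\<eta> \<le> 1 / L"
    and x_init: "\<And>\<omega>. \<omega> \<in> space M \<Longrightarrow> x 1 \<omega> = x1"
    and x_step: "\<And>t \<omega>. \<lbrakk>t \<in> {1..T}; \<omega> \<in> space M\<rbrakk> \<Longrightarrow>
           x (Suc t) \<omega> = x t \<omega> - \<eta> *\<^sub>R
             mlmc_gradient F A G T (J t \<omega>) (\<lambda>i k. \<xi> t i k \<omega>) (\<lambda>i j. b t i j \<omega>) (x t \<omega>)"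
begin

definition noise :: "real^'d \<Rightarrow> 'z \<Rightarrow> real^'d" where
  "noise y z = grad (\<lambda>u. F u z) y - grad f y"

definition msg :: "nat \<Rightarrow> nat \<Rightarrow> 'o \<Rightarrow> (real^'d)^'w" where
  "msg t j \<omega> = messages F G (\<lambda>i k. \<xi> t i k \<omega>) (\<lambda>i j. b t i j \<omega>) (x t \<omega>) j"

definition ghat :: "nat \<Rightarrow> nat \<Rightarrow> 'o \<Rightarrow> real^'d" where
  "ghat t j \<omega> = A (msg t j \<omega>)"

definition gmean :: "nat \<Rightarrow> nat \<Rightarrow> 'o \<Rightarrow> real^'d" where
  "gmean t j \<omega> = mean_over G (msg t j \<omega>)"

definition gt :: "nat \<Rightarrow> 'o \<Rightarrow> real^'d" where
  "gt t \<omega> = mlmc_gradient F A G T (J t \<omega>) (\<lambda>i k. \<xi> t i k \<omega>) (\<lambda>i j. b t i j \<omega>) (x t \<omega>)"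

definition sample_family :: "nat \<Rightarrow> 'o \<Rightarrow> 'w \<times> nat \<Rightarrow> 'z" where
  "sample_family t \<omega> = (\<lambda>(i, k)\<in>G \<times> {1..}. \<xi> t i k \<omega>)"

definition gamma :: real where "gamma = \<kappa> + 1 / real CARD('w)"

definition levels :: nat where "levels = nat \<lfloor>log 2 (real T)\<rfloor>"

definition fmin :: real where "fmin = (INF y. f y)"

section \<open>Consequences of robustness\<close>

lemma kappa_nonneg: "0 \<le> \<kappa>"
  using robust by (simp add: robust_aggregator_def)

lemma card_G_pos: "0 < card G"
  using card_G robust by (cases "card G = 0") (auto simp: robust_aggregator_def)

lemma G_nonempty: "G \<noteq> {}"
  using card_G_pos by auto

text \<open>Honest workers form a majority, as \<delta> < 1/2. This is the only loss in passing from
  an average over \<open>G\<close> to the term 1/m of \<gamma>.\<close>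

lemma inverse_card_G_le: "1 / real (card G) \<le> 2 / real CARD('w)"
proof -
  have "\<delta> * real CARD('w) \<le> 1/2 * real CARD('w)"
    using robust by (intro mult_right_mono) (auto simp: robust_aggregator_def)
  then have "real CARD('w) \<le> 2 * real (card G)"
    by (simp add: card_G algebra_simps)
  then show ?thesis using card_G_pos by (simp add: divide_simps)
qed

lemma robust_G:
  "(norm (A g - mean_over G g))\<^sup>2
     \<le> \<kappa> / real (card G) * (\<Sum>i\<in>G. (norm (g $ i - mean_over G g))\<^sup>2)"
  using robust card_G unfolding robust_aggregator_def by blast

text \<open>The mean minimizes the sum of squared distances, the cross term being zero. The
  robustness bound can therefore be recentred at the true gradient, where the honest deviations are
  pure noise.\<close>

lemma sum_norm_mean_over_le:
  "(\<Sum>i\<in>G. (norm (g $ i - mean_over G g))\<^sup>2) \<le> (\<Sum>i\<in>G. (norm (g $ i - c))\<^sup>2)"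
proof -
  let ?m = "mean_over G g"
  have z: "(\<Sum>i\<in>G. g $ i - ?m) = 0"
    using card_G_pos by (simp add: sum_subtractf mean_over_def sum_constant_scaleR del: sum_constant)
  have "(\<Sum>i\<in>G. (norm (g $ i - c))\<^sup>2)
      = (\<Sum>i\<in>G. (norm (g $ i - ?m))\<^sup>2 + 2 * ((g $ i - ?m) \<bullet> (?m - c)) + (norm (?m - c))\<^sup>2)"
    by (intro sum.cong refl)
       (simp add: power2_norm_eq_inner inner_diff_left inner_diff_right inner_commute algebra_simps)
  also have "\<dots> = (\<Sum>i\<in>G. (norm (g $ i - ?m))\<^sup>2) + 2 * ((\<Sum>i\<in>G. g $ i - ?m) \<bullet> (?m - c))
      + real (card G) * (norm (?m - c))\<^sup>2"
    by (simp only: sum.distrib sum_distrib_left inner_sum_left sum_constant)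
  finally show ?thesis unfolding z by simp
qed

section \<open>Measurability of gradients and noise\<close>

lemma grad_f_measurable [measurable]: "grad f \<in> borel_measurable borel"
proof -
  \<comment> \<open>A single function is treated as a family over a one-point sample space.\<close>
  have "(\<lambda>(y, z::unit). grad (\<lambda>u. f u) y) \<in> borel_measurable (borel \<Otimes>\<^sub>M count_space UNIV)"
    by (rule borel_measurable_grad) (use smooth in \<open>auto simp: L_smooth_def\<close>)
  from measurable_compose[OF _ this, of "\<lambda>y. (y, ())" borel] show ?thesis by simp
qed

lemma f_measurable [measurable]: "f \<in> borel_measurable borel"
proof (rule borel_measurable_continuous_onI)
  show "continuous_on UNIV f"
    using smooth unfolding L_smooth_def
    by (meson differentiable_imp_continuous_within continuous_at_imp_continuous_on)
qed

lemma noise_measurable [measurable]: "(\<lambda>(y, z). noise y z) \<in> borel_measurable (borel \<Otimes>\<^sub>M D)"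
proof -
  have [measurable]: "(\<lambda>(y, z). grad (\<lambda>u. F u z) y) \<in> borel_measurable (borel \<Otimes>\<^sub>M D)"
    by (rule borel_measurable_grad) (use F_diff F_integrable in auto)
  have "(\<lambda>p. (case p of (y, z) \<Rightarrow> grad (\<lambda>u. F u z) y) - grad f (fst p))
      \<in> borel_measurable (borel \<Otimes>\<^sub>M D)"
    by measurable
  then show ?thesis by (simp add: noise_def case_prod_beta')
qed

lemma noise_compose [measurable (raw)]:
  assumes "X \<in> borel_measurable N" "Z \<in> N \<rightarrow>\<^sub>M D"
  shows "(\<lambda>\<omega>. noise (X \<omega>) (Z \<omega>)) \<in> borel_measurable N"
  using measurable_compose[OF measurable_Pair[OF assms] noise_measurable] by simp

lemma subalg_H: "t \<in> {1..T} \<Longrightarrow> subalgebra M (\<H> t)"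
  using H_sub_F[of t] F_subalgebra[of t] by (auto simp: subalgebra_def)

section \<open>Laws and independence of the samples\<close>

lemma sample_rv:
  assumes "t \<in> {1..T}" "p \<in> G \<times> {1..}"
  shows "\<xi> t (fst p) (snd p) \<in> M \<rightarrow>\<^sub>M D"
  using assms by (intro measurable_from_subalg[OF subalg_H sample_measurable]) auto

lemma sample_family_measurable:
  assumes "t \<in> {1..T}"
  shows "sample_family t \<in> M \<rightarrow>\<^sub>M PiM (G \<times> {1..}) (\<lambda>_. D)"
  unfolding sample_family_def[abs_def]
  by (rule measurable_restrict[where X="\<lambda>p \<omega>. case p of (i, k) \<Rightarrow> \<xi> t i k \<omega>"])
     (use sample_rv[OF assms] in \<open>force simp: case_prod_beta\<close>)

lemma sample_integral:
  fixes h :: "'z \<Rightarrow> 'b::{banach, second_countable_topology}"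
  assumes t: "t \<in> {1..T}" and p: "p \<in> G \<times> {1..}" and h: "h \<in> borel_measurable D"
  shows "integrable M (\<lambda>\<omega>. h (\<xi> t (fst p) (snd p) \<omega>)) \<longleftrightarrow> integrable D h"
    and "(\<integral>\<omega>. h (\<xi> t (fst p) (snd p) \<omega>) \<partial>M) = (\<integral>z. h z \<partial>D)"
proof -
  have d: "distr M D (\<xi> t (fst p) (snd p)) = D"
    using t p by (intro sample_distr) auto
  show "integrable M (\<lambda>\<omega>. h (\<xi> t (fst p) (snd p) \<omega>)) \<longleftrightarrow> integrable D h"
    using integrable_distr_eq[OF sample_rv[OF t p] h] by (simp add: d)
  show "(\<integral>\<omega>. h (\<xi> t (fst p) (snd p) \<omega>) \<partial>M) = (\<integral>z. h z \<partial>D)"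
    using integral_distr[OF sample_rv[OF t p] h] by (simp add: d)
qed

lemma noise_section [measurable]: "noise y \<in> borel_measurable D"
  using noise_compose[of "\<lambda>_. y" D "\<lambda>z. z"] by simp

lemma noise_mean: "(\<integral>z. noise y z \<partial>D) = 0"
  unfolding noise_def using gradF_integrable gradF_mean by (simp add: D.prob_space)

lemma noise_square:
  "integrable D (\<lambda>z. (norm (noise y z))\<^sup>2)" "(\<integral>z. (norm (noise y z))\<^sup>2 \<partial>D) \<le> \<sigma>\<^sup>2"
  unfolding noise_def by (fact var_integrable var_le)+

lemma noise_integrable: "integrable D (noise y)"
  unfolding noise_def[abs_def] using gradF_integrable by simp

text \<open>The independent family is restricted to the disjoint blocks \<open>{p}\<close> and
  \<open>{q}\<close>, and each block is then projected to its only coordinate.\<close>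

lemma samples_pairwise_indep:
  assumes t: "t \<in> {1..T}" and p: "p \<in> G \<times> {1..}" and q: "q \<in> G \<times> {1..}" and "p \<noteq> q"
  shows "indep_var D (\<xi> t (fst p) (snd p)) D (\<xi> t (fst q) (snd q))"
proof -
  have "indep_var (PiM {p} (\<lambda>_. D)) (\<lambda>\<omega>. restrict (\<lambda>r. (\<lambda>(i, k). \<xi> t i k) r \<omega>) {p})
                  (PiM {q} (\<lambda>_. D)) (\<lambda>\<omega>. restrict (\<lambda>r. (\<lambda>(i, k). \<xi> t i k) r \<omega>) {q})"
    using assms by (intro indep_var_restrict[OF samples_indep]) auto
  from indep_var_compose[OF this, of "\<lambda>h. h p" D "\<lambda>h. h q" D]
  show ?thesis by (simp add: comp_def case_prod_beta)
qed

text \<open>At a fixed point the noise terms are centred and pairwise independent, hence orthogonal.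
  The extended nonnegative form is what \<open>nn_integral_indep_le\<close> takes as input.\<close>

lemma noise_sum_fixed:
  assumes t: "t \<in> {1..T}" and P: "finite P" "P \<subseteq> G \<times> {1..}"
  shows "(\<integral>\<^sup>+\<omega>. ennreal ((norm (\<Sum>p\<in>P. c p *\<^sub>R noise y (\<xi> t (fst p) (snd p) \<omega>)))\<^sup>2) \<partial>M)
      \<le> ennreal (\<sigma>\<^sup>2 * (\<Sum>p\<in>P. (c p)\<^sup>2))"
proof -
  let ?Y = "\<lambda>p \<omega>. noise y (\<xi> t (fst p) (snd p) \<omega>)"
  have rv[measurable]: "\<xi> t (fst p) (snd p) \<in> M \<rightarrow>\<^sub>M D" if "p \<in> P" for p
    using sample_rv[OF t] that P by auto
  have sq: "integrable M (\<lambda>\<omega>. (norm (?Y p \<omega>))\<^sup>2)" if "p \<in> P" for p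
    using that P noise_square(1)
    by (subst sample_integral(1)[OF t, where h="\<lambda>z. (norm (noise y z))\<^sup>2"]) auto
  have le: "(\<integral>\<omega>. (norm (?Y p \<omega>))\<^sup>2 \<partial>M) \<le> \<sigma>\<^sup>2" if "p \<in> P" for p
    using that P noise_square(2)
    by (subst sample_integral(2)[OF t, where h="\<lambda>z. (norm (noise y z))\<^sup>2"]) auto
  have orth: "(\<integral>\<omega>. ?Y p \<omega> \<bullet> ?Y q \<omega> \<partial>M) = 0" if "p \<in> P" "q \<in> P" "p \<noteq> q" for p q
  proof -
    have q: "q \<in> G \<times> {1..}" using that P by auto
    have "(\<integral>\<omega>. noise y z \<bullet> ?Y q \<omega> \<partial>M) = 0" for z
      using noise_integrable q noise_mean
      by (subst integral_inner_right) (auto simp: sample_integral[OF t, where h="noise y"])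
    moreover have "integrable M (\<lambda>\<omega>. ?Y p \<omega> \<bullet> ?Y q \<omega>)"
      using that sq by (intro integrable_inner_of_squares) auto
    moreover have "indep_var D (\<xi> t (fst p) (snd p)) D (\<xi> t (fst q) (snd q))"
      using that P by (intro samples_pairwise_indep[OF t]) auto
    then have "distr M (D \<Otimes>\<^sub>M D) (\<lambda>\<omega>. (\<xi> t (fst p) (snd p) \<omega>, \<xi> t (fst q) (snd q) \<omega>))
        = distr M D (\<xi> t (fst p) (snd p)) \<Otimes>\<^sub>M distr M D (\<xi> t (fst q) (snd q))"
      by (simp add: indep_var_distribution_eq)
    ultimately show ?thesis
      using integral_indep_eq_0[OF rv[OF that(1)] rv[OF that(2)],
          where h="\<lambda>(z, z'). noise y z \<bullet> noise y z'"]
      by simp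
  qed
  have m: "?Y p \<in> borel_measurable M" if "p \<in> P" for p
    using that by measurable
  note W = weighted_sum_orthogonal[OF P(1), of ?Y M "\<sigma>\<^sup>2" c, OF m sq le orth]
  show ?thesis
    using W by (subst nn_integral_eq_integral) (auto intro!: ennreal_leI)
qed

text \<open>The map \<open>h\<close> allows the whole family of samples or a single coordinate to be
  paired with a quantity of the past.\<close>

lemma iterate_indep_samples:
  assumes t: "t \<in> {1..T}" and X: "X \<in> \<F> (t - 1) \<rightarrow>\<^sub>M S"
    and h: "h \<in> PiM (G \<times> {1..}) (\<lambda>_. D) \<rightarrow>\<^sub>M R"
  shows "distr M (S \<Otimes>\<^sub>M R) (\<lambda>\<omega>. (X \<omega>, h (sample_family t \<omega>)))
           = distr M S X \<Otimes>\<^sub>M distr M R (\<lambda>\<omega>. h (sample_family t \<omega>))"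
proof (rule distr_pair_of_indep_set[OF _ _ X])
  let ?H = "vimage_algebra (space M) (sample_family t) (PiM (G \<times> {1..}) (\<lambda>_. D))"
  show "indep_set (sets (\<F> (t - 1))) (sets ?H)"
    using samples_fresh[OF t] by (simp add: sample_family_def[abs_def])
  show "subalgebra M (\<F> (t - 1))" using t by (intro F_subalgebra) auto
  show "subalgebra M ?H"
    by (rule subalgebra_vimage_algebra[OF sample_family_measurable[OF t]])
  have "sample_family t \<in> ?H \<rightarrow>\<^sub>M PiM (G \<times> {1..}) (\<lambda>_. D)"
    using measurable_space[OF sample_family_measurable[OF t]]
    by (intro measurable_vimage_algebra1) auto
  then show "(\<lambda>\<omega>. h (sample_family t \<omega>)) \<in> ?H \<rightarrow>\<^sub>M R"
    using h by (rule measurable_compose)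
qed

text \<open>The fixed-point bound survives the substitution of the random iterate because it is
  uniform in the point and the samples are fresh. Finiteness of the nonnegative integral then yields
  integrability.\<close>

lemma noise_sum:
  assumes t: "t \<in> {1..T}" and X: "x t \<in> borel_measurable (\<F> (t - 1))"
    and P: "finite P" "P \<subseteq> G \<times> {1..}"
  shows "integrable M (\<lambda>\<omega>. (norm (\<Sum>p\<in>P. c p *\<^sub>R noise (x t \<omega>) (\<xi> t (fst p) (snd p) \<omega>)))\<^sup>2)"
      (is "integrable M ?s")
    and "(\<integral>\<omega>. (norm (\<Sum>p\<in>P. c p *\<^sub>R noise (x t \<omega>) (\<xi> t (fst p) (snd p) \<omega>)))\<^sup>2 \<partial>M)
      \<le> \<sigma>\<^sup>2 * (\<Sum>p\<in>P. (c p)\<^sup>2)"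
proof -
  let ?h = "\<lambda>(y, z). ennreal ((norm (\<Sum>p\<in>P. c p *\<^sub>R noise y (z p)))\<^sup>2)"
  have [measurable]: "(\<lambda>z. z p) \<in> PiM (G \<times> {1..}) (\<lambda>_. D) \<rightarrow>\<^sub>M D" if "p \<in> P" for p
    using that P by (intro measurable_component_singleton) auto
  have rv[measurable]: "\<xi> t (fst p) (snd p) \<in> M \<rightarrow>\<^sub>M D" if "p \<in> P" for p
    using sample_rv[OF t] that P by auto
  have [measurable]: "x t \<in> borel_measurable M"
    using X t by (intro measurable_from_subalg[OF F_subalgebra]) auto
  have fam: "sample_family t \<omega> p = \<xi> t (fst p) (snd p) \<omega>" if "p \<in> P" for p \<omega>
    using that P by (auto simp: sample_family_def)
  have "(\<integral>\<^sup>+\<omega>. ?h (x t \<omega>, sample_family t \<omega>) \<partial>M) \<le> ennreal (\<sigma>\<^sup>2 * (\<Sum>p\<in>P. (c p)\<^sup>2))"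
  proof (rule nn_integral_indep_le[OF _ sample_family_measurable[OF t]
        iterate_indep_samples[OF t X, where h="\<lambda>z. z"]])
    show "x t \<in> borel_measurable M" by measurable
    show "(\<lambda>z. z) \<in> PiM (G \<times> {1..}) (\<lambda>_. D) \<rightarrow>\<^sub>M PiM (G \<times> {1..}) (\<lambda>_. D)"
      by measurable
    show "?h \<in> borel_measurable (borel \<Otimes>\<^sub>M PiM (G \<times> {1..}) (\<lambda>_. D))"
      by measurable
    show "(\<integral>\<^sup>+\<omega>. ?h (y, sample_family t \<omega>) \<partial>M) \<le> ennreal (\<sigma>\<^sup>2 * (\<Sum>p\<in>P. (c p)\<^sup>2))" for y
      using noise_sum_fixed[OF t P, of c y] by (simp add: fam cong: sum.cong)
  qed
  then have le: "(\<integral>\<^sup>+\<omega>. ennreal (?s \<omega>) \<partial>M) \<le> ennreal (\<sigma>\<^sup>2 * (\<Sum>p\<in>P. (c p)\<^sup>2))"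
    by (simp add: fam cong: sum.cong)
  have m: "?s \<in> borel_measurable M" by measurable
  show int: "integrable M ?s"
    using m le by (intro integrableI_bounded) (auto intro: le_less_trans)
  have "ennreal (\<integral>\<omega>. ?s \<omega> \<partial>M) \<le> ennreal (\<sigma>\<^sup>2 * (\<Sum>p\<in>P. (c p)\<^sup>2))"
    using le by (subst nn_integral_eq_integral[OF int, symmetric]) auto
  then show "(\<integral>\<omega>. ?s \<omega> \<partial>M) \<le> \<sigma>\<^sup>2 * (\<Sum>p\<in>P. (c p)\<^sup>2)"
    by (simp add: ennreal_le_iff sum_nonneg)
qed

text \<open>With the iterate frozen, a constant vector is paired with centred noise. In this form
  unbiasedness of the honest averages enters \<open>gt_bias\<close>.\<close>

lemma noise_orthogonal_iterate:
  assumes t: "t \<in> {1..T}" and X: "x t \<in> borel_measurable (\<F> (t - 1))" and p: "p \<in> G \<times> {1..}"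
    and sq: "integrable M (\<lambda>\<omega>. (norm (grad f (x t \<omega>)))\<^sup>2)"
  shows "integrable M (\<lambda>\<omega>. grad f (x t \<omega>) \<bullet> noise (x t \<omega>) (\<xi> t (fst p) (snd p) \<omega>))"
    and "(\<integral>\<omega>. grad f (x t \<omega>) \<bullet> noise (x t \<omega>) (\<xi> t (fst p) (snd p) \<omega>) \<partial>M) = 0"
proof -
  note [measurable] = sample_rv[OF t p]
  have [measurable]: "x t \<in> borel_measurable M"
    using X t by (intro measurable_from_subalg[OF F_subalgebra]) auto
  show int: "integrable M (\<lambda>\<omega>. grad f (x t \<omega>) \<bullet> noise (x t \<omega>) (\<xi> t (fst p) (snd p) \<omega>))"
    using sq noise_sum(1)[OF t X, of "{p}" "\<lambda>_. 1"] p
    by (intro integrable_inner_of_squares) auto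
  have "(\<integral>\<omega>. grad f y \<bullet> noise y (\<xi> t (fst p) (snd p) \<omega>) \<partial>M) = 0" for y
    using noise_integrable p noise_mean
    by (subst integral_inner_right) (auto simp: sample_integral[OF t, where h="noise y"])
  moreover have "(\<lambda>\<omega>. sample_family t \<omega> p) = \<xi> t (fst p) (snd p)"
    using p by (auto simp: sample_family_def fun_eq_iff)
  then have "distr M (borel \<Otimes>\<^sub>M D) (\<lambda>\<omega>. (x t \<omega>, \<xi> t (fst p) (snd p) \<omega>))
      = distr M borel (x t) \<Otimes>\<^sub>M distr M D (\<xi> t (fst p) (snd p))"
    using iterate_indep_samples[OF t X, of "\<lambda>z. z p" D] p by (simp add: fun_eq_iff)
  ultimately show "(\<integral>\<omega>. grad f (x t \<omega>) \<bullet> noise (x t \<omega>) (\<xi> t (fst p) (snd p) \<omega>) \<partial>M) = 0"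
    using int integral_indep_eq_0[of "x t" borel "\<xi> t (fst p) (snd p)" D
        "\<lambda>(y, z). grad f y \<bullet> noise y z"]
    by simp
qed

subsection \<open>Aggregation error\<close>

lemma batch_grad_noise:
  "batch_grad F z j y - grad f y = (\<Sum>k=1..2^j. (1 / 2^j) *\<^sub>R noise y (z k))"
  by (simp add: batch_grad_def noise_def scaleR_right.sum[symmetric] sum_subtractf
      sum_constant_scaleR scaleR_diff_right del: sum_constant)

lemma msg_noise:
  assumes "i \<in> G"
  shows "msg t j \<omega> $ i - grad f (x t \<omega>)
    = (\<Sum>p\<in>{i} \<times> {1..2^j}. (1 / 2^j) *\<^sub>R noise (x t \<omega>) (\<xi> t (fst p) (snd p) \<omega>))"
  using assms
  by (simp add: msg_def messages_def batch_grad_noise sum.cartesian_product')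

lemma gmean_noise:
  "gmean t j \<omega> - grad f (x t \<omega>)
    = (\<Sum>p\<in>G \<times> {1..2^j}. (1 / (real (card G) * 2^j)) *\<^sub>R noise (x t \<omega>) (\<xi> t (fst p) (snd p) \<omega>))"
proof -
  have "gmean t j \<omega> - grad f (x t \<omega>)
      = (1 / real (card G)) *\<^sub>R (\<Sum>i\<in>G. msg t j \<omega> $ i - grad f (x t \<omega>))"
    using G_nonempty
    by (simp add: gmean_def mean_over_def sum_subtractf sum_constant_scaleR scaleR_diff_right
        del: sum_constant)
  also have "\<dots> = (1 / real (card G)) *\<^sub>R (\<Sum>i\<in>G. \<Sum>k=1..2^j. (1 / 2^j) *\<^sub>R noise (x t \<omega>) (\<xi> t i k \<omega>))"
    by (simp add: msg_noise sum.cartesian_product' cong: sum.cong)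
  also have "\<dots> = (\<Sum>p\<in>G \<times> {1..2^j}. (1 / (real (card G) * 2^j)) *\<^sub>R noise (x t \<omega>) (\<xi> t (fst p) (snd p) \<omega>))"
    by (simp add: sum.cartesian_product' scaleR_right.sum)
  finally show ?thesis .
qed

text \<open>The first 2^j samples occur at both levels and keep the weight difference 1/2^(j+1) -
  1/2^j = -1/2^(j+1), up to the factor 1/|G|; the new ones have the opposite weight. All weights
  thus have the same modulus, as in an average at level j+1.\<close>

lemma gmean_diff_noise:
  "gmean t (Suc j) \<omega> - gmean t j \<omega>
    = (\<Sum>p\<in>G \<times> {1..2^Suc j}. ((if snd p \<le> 2^j then - 1 else 1) / (real (card G) * 2^Suc j)) *\<^sub>R
        noise (x t \<omega>) (\<xi> t (fst p) (snd p) \<omega>))"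
proof -
  let ?n = "real (card G)" and ?N = "\<lambda>p. noise (x t \<omega>) (\<xi> t (fst p) (snd p) \<omega>)"
  have "(\<Sum>p\<in>G \<times> {1..2^j}. (1 / (?n * 2^j)) *\<^sub>R ?N p)
      = (\<Sum>p\<in>G \<times> {1..2^j}. (if snd p \<le> 2^j then 1 / (?n * 2^j) else 0) *\<^sub>R ?N p)"
    by (intro sum.cong) auto
  also have "\<dots> = (\<Sum>p\<in>G \<times> {1..2^Suc j}. (if snd p \<le> 2^j then 1 / (?n * 2^j) else 0) *\<^sub>R ?N p)"
    by (intro sum.mono_neutral_left) auto
  finally have "gmean t (Suc j) \<omega> - gmean t j \<omega>
      = (\<Sum>p\<in>G \<times> {1..2^Suc j}. (1 / (?n * 2^Suc j)) *\<^sub>R ?N p)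
        - (\<Sum>p\<in>G \<times> {1..2^Suc j}. (if snd p \<le> 2^j then 1 / (?n * 2^j) else 0) *\<^sub>R ?N p)"
    using gmean_noise[of t "Suc j" \<omega>] gmean_noise[of t j \<omega>] by (simp add: algebra_simps)
  also have "\<dots> = (\<Sum>p\<in>G \<times> {1..2^Suc j}. ((if snd p \<le> 2^j then - 1 else 1) / (?n * 2^Suc j)) *\<^sub>R ?N p)"
    unfolding sum_subtractf[symmetric] scaleR_diff_left[symmetric]
    using card_G_pos by (intro sum.cong refl arg_cong2[where f=scaleR]) (simp add: field_simps)
  finally show ?thesis .
qed

text \<open>Measurability is with respect to \<open>\<H> t\<close>, which excludes
  \<open>J t\<close>, so that independence of the level applies to everything computed from the
  messages.\<close>

lemma msg_measurable:
  assumes t: "t \<in> {1..T}" and X: "x t \<in> borel_measurable (\<F> (t - 1))"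
  shows "msg t j \<in> borel_measurable (\<H> t)"
proof -
  note [measurable] = measurable_from_subalg[OF F_sub_H[OF t] X]
  have "(\<lambda>\<omega>. msg t j \<omega> $ i) \<in> borel_measurable (\<H> t)" for i
  proof (cases "i \<in> G")
    case True
    then have [measurable]: "\<xi> t i k \<in> \<H> t \<rightarrow>\<^sub>M D" if "k \<in> {1..2^j}" for k
      using that t by (intro sample_measurable) auto
    have "(\<lambda>\<omega>. grad f (x t \<omega>) + (\<Sum>k=1..2^j. (1 / 2^j) *\<^sub>R noise (x t \<omega>) (\<xi> t i k \<omega>)))
        \<in> borel_measurable (\<H> t)"
      by measurable
    then show ?thesis
      using True by (simp only: batch_grad_noise[symmetric]) (simp add: msg_def messages_def)
  next
    case False
    then show ?thesis
      using byzantine_measurable[OF t False] by (simp add: msg_def messages_def)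
  qed
  then show ?thesis by (rule borel_measurable_vec)
qed

lemma ghat_measurable:
  assumes "t \<in> {1..T}" "x t \<in> borel_measurable (\<F> (t - 1))"
  shows "ghat t j \<in> borel_measurable (\<H> t)"
  using measurable_compose[OF msg_measurable[OF assms] A_borel] by (simp add: ghat_def[abs_def])

lemma gmean_measurable:
  assumes "t \<in> {1..T}" "x t \<in> borel_measurable (\<F> (t - 1))"
  shows "gmean t j \<in> borel_measurable (\<H> t)"
proof -
  have [measurable]: "(\<lambda>\<omega>. msg t j \<omega> $ i) \<in> borel_measurable (\<H> t)" for i
    using msg_measurable[OF assms]
    by (rule measurable_compose) (intro borel_measurable_continuous_onI continuous_intros)
  show ?thesis unfolding gmean_def[abs_def] mean_over_def by measurable
qed

lemma gmean_error:
  assumes t: "t \<in> {1..T}" and X: "x t \<in> borel_measurable (\<F> (t - 1))"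
  shows "integrable M (\<lambda>\<omega>. (norm (gmean t j \<omega> - grad f (x t \<omega>)))\<^sup>2)"
    and "(\<integral>\<omega>. (norm (gmean t j \<omega> - grad f (x t \<omega>)))\<^sup>2 \<partial>M) \<le> 2 / real CARD('w) * \<sigma>\<^sup>2 / 2^j"
proof -
  let ?c = "\<lambda>_::'w \<times> nat. 1 / (real (card G) * 2^j)"
  have P: "finite (G \<times> {1..2^j::nat})" "G \<times> {1..2^j} \<subseteq> G \<times> {1..}" by auto
  note S = noise_sum[OF t X P, of ?c, folded gmean_noise]
  show "integrable M (\<lambda>\<omega>. (norm (gmean t j \<omega> - grad f (x t \<omega>)))\<^sup>2)" by (fact S)
  have "(\<Sum>p\<in>G \<times> {1..2^j::nat}. (?c p)\<^sup>2) = 1 / real (card G) * (1 / 2^j)"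
    using card_G_pos by (simp add: card_cartesian_product power2_eq_square field_simps)
  also have "\<dots> \<le> 2 / real CARD('w) * (1 / 2^j)"
    by (intro mult_right_mono inverse_card_G_le) auto
  finally have le: "(\<Sum>p\<in>G \<times> {1..2^j::nat}. (?c p)\<^sup>2) \<le> 2 / real CARD('w) * (1 / 2^j)" .
  note S(2)
  also have "\<sigma>\<^sup>2 * (\<Sum>p\<in>G \<times> {1..2^j::nat}. (?c p)\<^sup>2) \<le> \<sigma>\<^sup>2 * (2 / real CARD('w) * (1 / 2^j))"
    using le by (rule mult_left_mono) simp
  also have "\<dots> = 2 / real CARD('w) * \<sigma>\<^sup>2 / 2^j"
    by (simp add: mult.commute[of "\<sigma>\<^sup>2"])
  finally show "(\<integral>\<omega>. (norm (gmean t j \<omega> - grad f (x t \<omega>)))\<^sup>2 \<partial>M) \<le> 2 / real CARD('w) * \<sigma>\<^sup>2 / 2^j" .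
qed

lemma gmean_diff_error:
  assumes t: "t \<in> {1..T}" and X: "x t \<in> borel_measurable (\<F> (t - 1))"
  shows "integrable M (\<lambda>\<omega>. (norm (gmean t (Suc j) \<omega> - gmean t j \<omega>))\<^sup>2)"
    and "(\<integral>\<omega>. (norm (gmean t (Suc j) \<omega> - gmean t j \<omega>))\<^sup>2 \<partial>M)
      \<le> 2 / real CARD('w) * \<sigma>\<^sup>2 / 2^Suc j"
proof -
  let ?c = "\<lambda>p::'w \<times> nat. (if snd p \<le> 2^j then - 1 else 1) / (real (card G) * 2^Suc j)"
  have P: "finite (G \<times> {1..2^Suc j::nat})" "G \<times> {1..2^Suc j} \<subseteq> G \<times> {1..}" by auto
  note S = noise_sum[OF t X P, of ?c, folded gmean_diff_noise]
  show "integrable M (\<lambda>\<omega>. (norm (gmean t (Suc j) \<omega> - gmean t j \<omega>))\<^sup>2)" by (fact S)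
  have "(\<Sum>p\<in>G \<times> {1..2^Suc j::nat}. (?c p)\<^sup>2)
      = (\<Sum>p\<in>G \<times> {1..2^Suc j::nat}. (1 / (real (card G) * 2^Suc j))\<^sup>2)"
    by (intro sum.cong refl) (simp add: power_divide)
  also have "\<dots> = 1 / real (card G) * (1 / 2^Suc j)"
    using G_nonempty by (simp add: card_cartesian_product power2_eq_square field_simps)
  also have "\<dots> \<le> 2 / real CARD('w) * (1 / 2^Suc j)"
    by (intro mult_right_mono inverse_card_G_le) auto
  finally have le: "(\<Sum>p\<in>G \<times> {1..2^Suc j::nat}. (?c p)\<^sup>2) \<le> 2 / real CARD('w) * (1 / 2^Suc j)" .
  note S(2)
  also have "\<sigma>\<^sup>2 * (\<Sum>p\<in>G \<times> {1..2^Suc j::nat}. (?c p)\<^sup>2) \<le> \<sigma>\<^sup>2 * (2 / real CARD('w) * (1 / 2^Suc j))"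
    using le by (rule mult_left_mono) simp
  also have "\<dots> = 2 / real CARD('w) * \<sigma>\<^sup>2 / 2^Suc j"
    by (simp add: mult.commute[of "\<sigma>\<^sup>2"])
  finally show "(\<integral>\<omega>. (norm (gmean t (Suc j) \<omega> - gmean t j \<omega>))\<^sup>2 \<partial>M)
      \<le> 2 / real CARD('w) * \<sigma>\<^sup>2 / 2^Suc j" .
qed

text \<open>Robustness holds pointwise for arbitrary Byzantine vectors, and its right-hand side
  involves honest messages only. After recentring, each honest deviation is a minibatch noise of
  mean square at most \<sigma>^2 / 2^j.\<close>

lemma aggregation_error:
  assumes t: "t \<in> {1..T}" and X: "x t \<in> borel_measurable (\<F> (t - 1))"
  shows "integrable M (\<lambda>\<omega>. (norm (ghat t j \<omega> - gmean t j \<omega>))\<^sup>2)"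
    and "(\<integral>\<omega>. (norm (ghat t j \<omega> - gmean t j \<omega>))\<^sup>2 \<partial>M) \<le> \<kappa> * \<sigma>\<^sup>2 / 2^j"
proof -
  let ?W = "\<lambda>i \<omega>. (norm (msg t j \<omega> $ i - grad f (x t \<omega>)))\<^sup>2"
  let ?n = "real (card G)"
  note [measurable] = measurable_from_subalg[OF subalg_H[OF t] ghat_measurable[OF t X]]
    measurable_from_subalg[OF subalg_H[OF t] gmean_measurable[OF t X]]
  have W: "integrable M (?W i)" "(\<integral>\<omega>. ?W i \<omega> \<partial>M) \<le> \<sigma>\<^sup>2 / 2^j" if "i \<in> G" for i
  proof -
    have P: "finite ({i} \<times> {1..2^j::nat})" "{i} \<times> {1..2^j} \<subseteq> G \<times> {1..}" using that by auto
    note S = noise_sum[OF t X P, of "\<lambda>_. 1 / 2^j", folded msg_noise[OF that]]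
    show "integrable M (?W i)" by (fact S)
    have "(\<Sum>p\<in>{i} \<times> {1..2^j::nat}. (1 / 2^j)\<^sup>2 :: real) = 1 / 2^j"
      by (simp add: card_cartesian_product power2_eq_square)
    then show "(\<integral>\<omega>. ?W i \<omega> \<partial>M) \<le> \<sigma>\<^sup>2 / 2^j"
      using S(2) by simp
  qed
  have pt: "(norm (ghat t j \<omega> - gmean t j \<omega>))\<^sup>2 \<le> \<kappa> / ?n * (\<Sum>i\<in>G. ?W i \<omega>)" for \<omega>
    unfolding ghat_def gmean_def
    using kappa_nonneg
    by (intro order_trans[OF robust_G] mult_left_mono sum_norm_mean_over_le) simp
  have int: "integrable M (\<lambda>\<omega>. \<kappa> / ?n * (\<Sum>i\<in>G. ?W i \<omega>))"
    using W(1) by auto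
  show I: "integrable M (\<lambda>\<omega>. (norm (ghat t j \<omega> - gmean t j \<omega>))\<^sup>2)"
  proof (rule integrable_of_nonneg_le[OF int])
    show "(\<lambda>\<omega>. (norm (ghat t j \<omega> - gmean t j \<omega>))\<^sup>2) \<in> borel_measurable M" by measurable
  qed (use pt in auto)
  have "(\<integral>\<omega>. (norm (ghat t j \<omega> - gmean t j \<omega>))\<^sup>2 \<partial>M) \<le> (\<integral>\<omega>. \<kappa> / ?n * (\<Sum>i\<in>G. ?W i \<omega>) \<partial>M)"
    by (rule integral_mono[OF I int pt])
  also have "\<dots> = \<kappa> / ?n * (\<Sum>i\<in>G. \<integral>\<omega>. ?W i \<omega> \<partial>M)"
    using W(1) by simp
  also have "\<dots> \<le> \<kappa> / ?n * (\<Sum>i\<in>G. \<sigma>\<^sup>2 / 2^j)"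
    using W(2) kappa_nonneg by (intro mult_left_mono sum_mono) auto
  also have "\<dots> = \<kappa> * \<sigma>\<^sup>2 / 2^j"
    using G_nonempty by simp
  finally show "(\<integral>\<omega>. (norm (ghat t j \<omega> - gmean t j \<omega>))\<^sup>2 \<partial>M) \<le> \<kappa> * \<sigma>\<^sup>2 / 2^j" .
qed

subsection \<open>The multilevel estimator\<close>

lemma gamma_pos: "0 < gamma"
  using kappa_nonneg by (simp add: gamma_def add_nonneg_pos)

lemma kappa_le_gamma: "\<kappa> \<le> gamma"
  by (simp add: gamma_def)

lemma level_le_iff: "int k \<le> \<lfloor>log 2 (real T)\<rfloor> \<longleftrightarrow> k \<le> levels"
  using T_ge_1 by (auto simp: levels_def zero_le_floor nat_le_iff le_nat_iff)

text \<open>Indicators turn the random level into a finite sum over fixed levels, to which linearity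
  of expectation applies. The index is shifted because levels start at 1.\<close>

lemma gt_decomp:
  "gt t \<omega> - grad f (x t \<omega>) = (ghat t 0 \<omega> - grad f (x t \<omega>))
     + (\<Sum>j<levels. (2^Suc j * of_bool (J t \<omega> = Suc j)) *\<^sub>R (ghat t (Suc j) \<omega> - ghat t j \<omega>))"
proof -
  let ?s = "\<Sum>j<levels. (2^Suc j * of_bool (J t \<omega> = Suc j)) *\<^sub>R (ghat t (Suc j) \<omega> - ghat t j \<omega>)"
  have g: "gt t \<omega> = (if J t \<omega> \<le> levels
      then ghat t 0 \<omega> + 2^J t \<omega> *\<^sub>R (ghat t (J t \<omega>) \<omega> - ghat t (J t \<omega> - 1) \<omega>) else ghat t 0 \<omega>)"
    by (simp add: gt_def mlmc_gradient_def ghat_def msg_def level_le_iff)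
  show ?thesis
  proof (cases "\<exists>k<levels. J t \<omega> = Suc k")
    case True
    then obtain k where k: "k < levels" "J t \<omega> = Suc k" by blast
    have "?s = (\<Sum>j<levels. if k = j then 2^Suc j *\<^sub>R (ghat t (Suc j) \<omega> - ghat t j \<omega>) else 0)"
      using k by (intro sum.cong) auto
    also have "\<dots> = 2^Suc k *\<^sub>R (ghat t (Suc k) \<omega> - ghat t k \<omega>)"
      using k by simp
    finally show ?thesis using k by (simp add: g)
  next
    case False
    then have "?s = 0" by (intro sum.neutral) auto
    \<comment> \<open>For \<open>J t\<close> equal to 0 truncated subtraction makes both levels of
      the correction equal, so it vanishes.\<close>
    moreover have "gt t \<omega> = ghat t 0 \<omega>"
      using False by (cases "J t \<omega>") (auto simp: g)
    ultimately show ?thesis by simp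
  qed
qed

text \<open>At most one of the indicators is nonzero, so the cross terms vanish.\<close>
lemma level_sum_norm:
  "(norm (\<Sum>j<N. (2^Suc j * of_bool (J t \<omega> = Suc j)) *\<^sub>R d j))\<^sup>2
     = (\<Sum>j<N. 4^Suc j * ((norm (d j :: real^'d))\<^sup>2 * of_bool (J t \<omega> = Suc j)))"
proof (cases "\<exists>k<N. J t \<omega> = Suc k")
  case True
  then obtain k where k: "k < N" "J t \<omega> = Suc k" by blast
  have "(\<Sum>j<N. (2^Suc j * of_bool (J t \<omega> = Suc j)) *\<^sub>R d j)
      = (\<Sum>j<N. if k = j then 2^Suc j *\<^sub>R d j else 0)"
    using k by (intro sum.cong) auto
  also have "\<dots> = 2^Suc k *\<^sub>R d k" using k by simp
  finally have "(norm (\<Sum>j<N. (2^Suc j * of_bool (J t \<omega> = Suc j)) *\<^sub>R d j))\<^sup>2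
      = (2^Suc k)\<^sup>2 * (norm (d k))\<^sup>2"
    by (simp add: power_mult_distrib)
  also have "(2^Suc k)\<^sup>2 = (4^Suc k :: real)"
    by (simp add: power_mult_distrib power2_eq_square flip: power_mult_distrib)
  also have "4^Suc k * (norm (d k))\<^sup>2
      = (\<Sum>j<N. if k = j then 4^Suc j * (norm (d j))\<^sup>2 else 0)"
    using k by simp
  also have "\<dots> = (\<Sum>j<N. 4^Suc j * ((norm (d j))\<^sup>2 * of_bool (J t \<omega> = Suc j)))"
    using k by (intro sum.cong) auto
  finally show ?thesis .
next
  case False
  then have "(\<Sum>j<N. (2^Suc j * of_bool (J t \<omega> = Suc j)) *\<^sub>R d j) = 0"
    "(\<Sum>j<N. 4^Suc j * ((norm (d j))\<^sup>2 * of_bool (J t \<omega> = Suc j))) = 0"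
    by (intro sum.neutral; auto)+
  then show ?thesis by simp
qed

text \<open>8 is twice the constant 4 of \<open>ghat_error\<close>, and 18 is twice the constant 9
  of \<open>ghat_diff_error\<close>; the doubling comes from separating base level and
  correction.\<close>

definition noise_bound :: real where
  "noise_bound = (8 + 18 * real levels) * gamma * \<sigma>\<^sup>2"

section \<open>One round, started from an iterate determined by the past\<close>

context
  fixes t
  assumes t: "t \<in> {1..T}" and X: "x t \<in> borel_measurable (\<F> (t - 1))"
begin

lemma rv [measurable]:
  "x t \<in> borel_measurable M" "ghat t j \<in> borel_measurable M" "gmean t j \<in> borel_measurable M"
  "J t \<in> M \<rightarrow>\<^sub>M count_space UNIV"
proof -
  show "x t \<in> borel_measurable M"
    using X t by (intro measurable_from_subalg[OF F_subalgebra]) auto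
  show "ghat t j \<in> borel_measurable M" "gmean t j \<in> borel_measurable M"
    using measurable_from_subalg[OF subalg_H[OF t]] ghat_measurable[OF t X]
      gmean_measurable[OF t X] by blast+
  show "J t \<in> M \<rightarrow>\<^sub>M count_space UNIV"
    using t by (intro measurable_from_subalg[OF F_subalgebra level_measurable]) auto
qed

text \<open>Here \<open>J t\<close> enters, so the estimator belongs to \<open>\<F> t\<close>,
  whereas its ingredients \<open>ghat t j\<close> already belong to \<open>\<H> t\<close>.\<close>

lemma gt_measurable: "gt t \<in> borel_measurable (\<F> t)"
proof -
  note [measurable] = measurable_from_subalg[OF H_sub_F[OF t] ghat_measurable[OF t X]]
    level_measurable[OF t]
  have [measurable]: "(\<lambda>\<omega>. of_bool (J t \<omega> = k) :: real) \<in> borel_measurable (\<F> t)" for k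
    using level_measurable[OF t] by (rule measurable_compose) simp
  have "gt t = (\<lambda>\<omega>. ghat t 0 \<omega> + (\<Sum>j<levels. (2^Suc j * of_bool (J t \<omega> = Suc j)) *\<^sub>R
      (ghat t (Suc j) \<omega> - ghat t j \<omega>)))"
    using gt_decomp[of t] by (simp add: fun_eq_iff)
  also have "\<dots> \<in> borel_measurable (\<F> t)" by measurable
  finally show ?thesis .
qed

lemma gt_rv [measurable]: "gt t \<in> borel_measurable M"
  using t by (intro measurable_from_subalg[OF F_subalgebra gt_measurable]) auto

lemma ghat_error:
  shows "integrable M (\<lambda>\<omega>. (norm (ghat t j \<omega> - grad f (x t \<omega>)))\<^sup>2)"
    and "(\<integral>\<omega>. (norm (ghat t j \<omega> - grad f (x t \<omega>)))\<^sup>2 \<partial>M) \<le> 4 * gamma * \<sigma>\<^sup>2 / 2^j"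
proof -
  let ?a = "\<lambda>\<omega>. (norm (ghat t j \<omega> - gmean t j \<omega>))\<^sup>2"
  let ?b = "\<lambda>\<omega>. (norm (gmean t j \<omega> - grad f (x t \<omega>)))\<^sup>2"
  note A = aggregation_error[OF t X, of j] and B = gmean_error[OF t X, of j]
  have int: "integrable M (\<lambda>\<omega>. 2 * ?a \<omega> + 2 * ?b \<omega>)" using A B by auto
  have pt: "(norm (ghat t j \<omega> - grad f (x t \<omega>)))\<^sup>2 \<le> 2 * ?a \<omega> + 2 * ?b \<omega>" for \<omega>
    using norm_add_squared_le[of "ghat t j \<omega> - gmean t j \<omega>" "gmean t j \<omega> - grad f (x t \<omega>)"] by simp
  show I: "integrable M (\<lambda>\<omega>. (norm (ghat t j \<omega> - grad f (x t \<omega>)))\<^sup>2)"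
    by (rule integrable_of_nonneg_le[OF int]) (use pt in simp_all)
  have "(\<integral>\<omega>. (norm (ghat t j \<omega> - grad f (x t \<omega>)))\<^sup>2 \<partial>M) \<le> (\<integral>\<omega>. 2 * ?a \<omega> + 2 * ?b \<omega> \<partial>M)"
    by (rule integral_mono[OF I int pt])
  also have "\<dots> = 2 * (\<integral>\<omega>. ?a \<omega> \<partial>M) + 2 * (\<integral>\<omega>. ?b \<omega> \<partial>M)"
    using A B by simp
  also have "\<dots> \<le> 2 * (\<kappa> * \<sigma>\<^sup>2 / 2^j) + 2 * (2 / real CARD('w) * \<sigma>\<^sup>2 / 2^j)"
    using A B by linarith
  also have "\<dots> = (2 * \<kappa> + 4 / real CARD('w)) * (\<sigma>\<^sup>2 / 2^j)"
    by (simp add: algebra_simps add_divide_distrib)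
  also have "\<dots> \<le> (4 * gamma) * (\<sigma>\<^sup>2 / 2^j)"
    using kappa_nonneg by (intro mult_right_mono) (auto simp: gamma_def)
  finally show "(\<integral>\<omega>. (norm (ghat t j \<omega> - grad f (x t \<omega>)))\<^sup>2 \<partial>M) \<le> 4 * gamma * \<sigma>\<^sup>2 / 2^j"
    by simp
qed

text \<open>Two aggregation errors and one honest difference are separated; 9\<kappa> is 3\<kappa>
  from the upper level plus 6\<kappa> from the lower. Applying \<open>ghat_error\<close> at both
  levels would give 24 instead of 9, more than \<open>learning_rate_tradeoff\<close> can
  absorb.\<close>

lemma ghat_diff_error:
  shows "integrable M (\<lambda>\<omega>. (norm (ghat t (Suc j) \<omega> - ghat t j \<omega>))\<^sup>2)"
    and "(\<integral>\<omega>. (norm (ghat t (Suc j) \<omega> - ghat t j \<omega>))\<^sup>2 \<partial>M) \<le> 9 * gamma * \<sigma>\<^sup>2 / 2^Suc j"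
proof -
  let ?a = "\<lambda>j \<omega>. (norm (ghat t j \<omega> - gmean t j \<omega>))\<^sup>2"
  let ?b = "\<lambda>\<omega>. (norm (gmean t (Suc j) \<omega> - gmean t j \<omega>))\<^sup>2"
  note A = aggregation_error[OF t X, of j] aggregation_error[OF t X, of "Suc j"]
    and B = gmean_diff_error[OF t X, of j]
  have int: "integrable M (\<lambda>\<omega>. 3 * ?a (Suc j) \<omega> + 3 * ?a j \<omega> + 3 * ?b \<omega>)"
    using A B by (intro Bochner_Integration.integrable_add integrable_mult_right) auto
  have pt: "(norm (ghat t (Suc j) \<omega> - ghat t j \<omega>))\<^sup>2 \<le> 3 * ?a (Suc j) \<omega> + 3 * ?a j \<omega> + 3 * ?b \<omega>"
    for \<omega>
    using norm_add3_squared_le[of "ghat t (Suc j) \<omega> - gmean t (Suc j) \<omega>"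
        "gmean t j \<omega> - ghat t j \<omega>" "gmean t (Suc j) \<omega> - gmean t j \<omega>"]
    by (simp add: norm_minus_commute)
  show I: "integrable M (\<lambda>\<omega>. (norm (ghat t (Suc j) \<omega> - ghat t j \<omega>))\<^sup>2)"
    by (rule integrable_of_nonneg_le[OF int]) (use pt in simp_all)
  have "(\<integral>\<omega>. (norm (ghat t (Suc j) \<omega> - ghat t j \<omega>))\<^sup>2 \<partial>M)
      \<le> (\<integral>\<omega>. 3 * ?a (Suc j) \<omega> + 3 * ?a j \<omega> + 3 * ?b \<omega> \<partial>M)"
    by (rule integral_mono[OF I int pt])
  also have "\<dots> = 3 * (\<integral>\<omega>. ?a (Suc j) \<omega> \<partial>M) + 3 * (\<integral>\<omega>. ?a j \<omega> \<partial>M) + 3 * (\<integral>\<omega>. ?b \<omega> \<partial>M)"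
    using A B by simp
  also have "\<dots> \<le> 3 * (\<kappa> * \<sigma>\<^sup>2 / 2^Suc j) + 3 * (\<kappa> * \<sigma>\<^sup>2 / 2^j)
      + 3 * (2 / real CARD('w) * \<sigma>\<^sup>2 / 2^Suc j)"
    using A B by linarith
  also have "\<dots> = (9 * \<kappa> + 6 / real CARD('w)) * (\<sigma>\<^sup>2 / 2^Suc j)"
    by (simp add: field_simps)
  also have "\<dots> \<le> (9 * gamma) * (\<sigma>\<^sup>2 / 2^Suc j)"
    by (intro mult_right_mono) (auto simp: gamma_def divide_right_mono)
  finally show "(\<integral>\<omega>. (norm (ghat t (Suc j) \<omega> - ghat t j \<omega>))\<^sup>2 \<partial>M) \<le> 9 * gamma * \<sigma>\<^sup>2 / 2^Suc j"
    by simp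
qed

lemma level_indicator:
  fixes Y :: "'o \<Rightarrow> real"
  assumes "Y \<in> borel_measurable (\<H> t)" "integrable M Y"
  shows "integrable M (\<lambda>\<omega>. Y \<omega> * of_bool (J t \<omega> = Suc j))"
    and "(\<integral>\<omega>. Y \<omega> * of_bool (J t \<omega> = Suc j) \<partial>M) = (\<integral>\<omega>. Y \<omega> \<partial>M) / 2^Suc j"
  using integral_mult_indicator_indep[OF level_indep[OF t] subalg_H[OF t] assms rv(4), of "Suc j"]
    level_geometric[OF t, of "Suc j"] by simp_all

text \<open>For each level the squared weight 4^(j+1), the probability 2^-(j+1) and the mean square
  gap of order 2^-(j+1) multiply to a constant.\<close>

lemma gt_error:
  shows "integrable M (\<lambda>\<omega>. (norm (gt t \<omega> - grad f (x t \<omega>)))\<^sup>2)"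
    and "(\<integral>\<omega>. (norm (gt t \<omega> - grad f (x t \<omega>)))\<^sup>2 \<partial>M) \<le> noise_bound"
proof -
  let ?a = "\<lambda>\<omega>. (norm (ghat t 0 \<omega> - grad f (x t \<omega>)))\<^sup>2"
  let ?d = "\<lambda>j \<omega>. (norm (ghat t (Suc j) \<omega> - ghat t j \<omega>))\<^sup>2"
  let ?i = "\<lambda>j \<omega>. of_bool (J t \<omega> = Suc j) :: real"
  have m: "?d j \<in> borel_measurable (\<H> t)" for j
    using ghat_measurable[OF t X] by measurable
  note I = level_indicator[OF m ghat_diff_error(1)]
  have int: "integrable M (\<lambda>\<omega>. 2 * ?a \<omega> + 2 * (\<Sum>j<levels. 4^Suc j * (?d j \<omega> * ?i j \<omega>)))"
    using ghat_error(1) I(1)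
    by (intro Bochner_Integration.integrable_add integrable_mult_right
        Bochner_Integration.integrable_sum) auto
  have pt: "(norm (gt t \<omega> - grad f (x t \<omega>)))\<^sup>2
      \<le> 2 * ?a \<omega> + 2 * (\<Sum>j<levels. 4^Suc j * (?d j \<omega> * ?i j \<omega>))" for \<omega>
    unfolding gt_decomp level_sum_norm[symmetric] by (rule norm_add_squared_le)
  show G: "integrable M (\<lambda>\<omega>. (norm (gt t \<omega> - grad f (x t \<omega>)))\<^sup>2)"
    by (rule integrable_of_nonneg_le[OF int]) (use pt in simp_all)
  have "(\<integral>\<omega>. (norm (gt t \<omega> - grad f (x t \<omega>)))\<^sup>2 \<partial>M)
      \<le> (\<integral>\<omega>. 2 * ?a \<omega> + 2 * (\<Sum>j<levels. 4^Suc j * (?d j \<omega> * ?i j \<omega>)) \<partial>M)"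
    by (rule integral_mono[OF G int pt])
  also have "\<dots> = 2 * (\<integral>\<omega>. ?a \<omega> \<partial>M) + 2 * (\<Sum>j<levels. 4^Suc j * ((\<integral>\<omega>. ?d j \<omega> \<partial>M) / 2^Suc j))"
    using ghat_error(1) I by (simp add: Bochner_Integration.integral_sum del: power_Suc)
  also have "\<dots> = 2 * (\<integral>\<omega>. ?a \<omega> \<partial>M) + 2 * (\<Sum>j<levels. 2^Suc j * (\<integral>\<omega>. ?d j \<omega> \<partial>M))"
  proof -
    have "(4::real)^Suc j * (c / 2^Suc j) = 2^Suc j * c" for j c
    proof -
      have "(4::real)^Suc j = 2^Suc j * 2^Suc j" by (simp flip: power_mult_distrib)
      then show ?thesis by simp
    qed
    then show ?thesis by (simp only:)
  qed
  also have "\<dots> \<le> 2 * (4 * gamma * \<sigma>\<^sup>2) + 2 * (\<Sum>j<levels. 9 * gamma * \<sigma>\<^sup>2)"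
  proof (intro add_mono mult_left_mono sum_mono)
    show "(\<integral>\<omega>. ?a \<omega> \<partial>M) \<le> 4 * gamma * \<sigma>\<^sup>2"
      using ghat_error(2)[of 0] by simp
    show "2^Suc j * (\<integral>\<omega>. ?d j \<omega> \<partial>M) \<le> 9 * gamma * \<sigma>\<^sup>2" for j
      using ghat_diff_error(2)[of j] by (simp add: field_simps)
  qed auto
  also have "\<dots> = noise_bound"
    by (simp add: noise_bound_def algebra_simps)
  finally show "(\<integral>\<omega>. (norm (gt t \<omega> - grad f (x t \<omega>)))\<^sup>2 \<partial>M) \<le> noise_bound" .
qed

text \<open>The bias is tested only against the gradient at the iterate, which is what the descent
  inequality needs and what total expectations can express.\<close>

lemma gt_bias:
  assumes sq: "integrable M (\<lambda>\<omega>. (norm (grad f (x t \<omega>)))\<^sup>2)"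
  shows "integrable M (\<lambda>\<omega>. grad f (x t \<omega>) \<bullet> (gt t \<omega> - grad f (x t \<omega>)))"
    and "- 2 * (\<integral>\<omega>. grad f (x t \<omega>) \<bullet> (gt t \<omega> - grad f (x t \<omega>)) \<partial>M)
      \<le> (\<integral>\<omega>. (norm (grad f (x t \<omega>)))\<^sup>2 \<partial>M) + \<kappa> * \<sigma>\<^sup>2 / 2^levels"
proof -
  let ?g = "\<lambda>\<omega>. grad f (x t \<omega>)"
  let ?r = "\<lambda>j. \<integral>\<omega>. ?g \<omega> \<bullet> (ghat t j \<omega> - ?g \<omega>) \<partial>M"
  let ?d = "\<lambda>j \<omega>. ?g \<omega> \<bullet> (ghat t (Suc j) \<omega> - ghat t j \<omega>)"
  let ?i = "\<lambda>j \<omega>. of_bool (J t \<omega> = Suc j) :: real"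
  show "integrable M (\<lambda>\<omega>. ?g \<omega> \<bullet> (gt t \<omega> - ?g \<omega>))"
    using sq gt_error(1) by (intro integrable_inner_of_squares) auto
  have r: "integrable M (\<lambda>\<omega>. ?g \<omega> \<bullet> (ghat t j \<omega> - ?g \<omega>))" for j
    using sq ghat_error(1) by (intro integrable_inner_of_squares) auto
  have d: "integrable M (?d j)" for j
    using sq ghat_diff_error(1) by (intro integrable_inner_of_squares) auto
  have m: "?d j \<in> borel_measurable (\<H> t)" for j
  proof -
    note [measurable] = ghat_measurable[OF t X] measurable_from_subalg[OF F_sub_H[OF t] X]
    show ?thesis by measurable
  qed
  note I = level_indicator[OF m d]
  have "(\<integral>\<omega>. ?g \<omega> \<bullet> (gt t \<omega> - ?g \<omega>) \<partial>M)
      = (\<integral>\<omega>. ?g \<omega> \<bullet> (ghat t 0 \<omega> - ?g \<omega>) + (\<Sum>j<levels. 2^Suc j * (?d j \<omega> * ?i j \<omega>)) \<partial>M)"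
    unfolding gt_decomp
    by (intro Bochner_Integration.integral_cong refl)
       (simp add: inner_add_right inner_sum_right mult_ac)
  also have "\<dots> = ?r 0 + (\<Sum>j<levels. 2^Suc j * ((\<integral>\<omega>. ?d j \<omega> \<partial>M) / 2^Suc j))"
    using r I by (simp add: Bochner_Integration.integral_sum del: power_Suc)
  \<comment> \<open>The weight cancels the probability of its level, leaving increments of
    \<open>?r\<close>.\<close>
  also have "(\<Sum>j<levels. 2^Suc j * ((\<integral>\<omega>. ?d j \<omega> \<partial>M) / 2^Suc j)) = (\<Sum>j<levels. ?r (Suc j) - ?r j)"
  proof (intro sum.cong refl)
    fix j
    have "?r (Suc j) - ?r j
        = (\<integral>\<omega>. ?g \<omega> \<bullet> (ghat t (Suc j) \<omega> - ?g \<omega>) - ?g \<omega> \<bullet> (ghat t j \<omega> - ?g \<omega>) \<partial>M)"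
      using r by simp
    also have "\<dots> = (\<integral>\<omega>. ?d j \<omega> \<partial>M)"
      by (intro Bochner_Integration.integral_cong refl) (simp add: inner_diff_right)
    finally show "2^Suc j * ((\<integral>\<omega>. ?d j \<omega> \<partial>M) / 2^Suc j) = ?r (Suc j) - ?r j" by simp
  qed
  also have "\<dots> = ?r levels - ?r 0" by (rule sum_lessThan_telescope)
  finally have eq: "(\<integral>\<omega>. ?g \<omega> \<bullet> (gt t \<omega> - ?g \<omega>) \<partial>M) = ?r levels" by simp
  \<comment> \<open>At the top level the honest noise is orthogonal to the gradient and is removed
    before Young's inequality, leaving \<kappa>. Using \<open>ghat_error\<close> here would cost 4
    \<open>gamma\<close> and end in 8\<sigma>^2 \<open>gamma\<close> where the final bound has
    4\<sigma>^2 \<open>gamma\<close>.\<close>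
  let ?e = "\<lambda>\<omega>. ghat t levels \<omega> - gmean t levels \<omega>"
  let ?N = "\<lambda>p \<omega>. ?g \<omega> \<bullet> noise (x t \<omega>) (\<xi> t (fst p) (snd p) \<omega>)"
  let ?P = "G \<times> {1..2^levels::nat}"
  let ?c = "1 / (real (card G) * 2^levels)"
  have n: "integrable M (?N p)" "(\<integral>\<omega>. ?N p \<omega> \<partial>M) = 0" if "p \<in> ?P" for p
    using that by (intro noise_orthogonal_iterate[OF t X _ sq]; auto)+
  have e: "integrable M (\<lambda>\<omega>. ?g \<omega> \<bullet> ?e \<omega>)"
    using sq aggregation_error(1)[OF t X] by (intro integrable_inner_of_squares) auto
  have "?r levels = (\<integral>\<omega>. ?g \<omega> \<bullet> ?e \<omega> + (\<Sum>p\<in>?P. ?c * ?N p \<omega>) \<partial>M)"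
  proof (intro Bochner_Integration.integral_cong refl)
    fix \<omega>
    have "?g \<omega> \<bullet> (ghat t levels \<omega> - ?g \<omega>) = ?g \<omega> \<bullet> ?e \<omega> + ?g \<omega> \<bullet> (gmean t levels \<omega> - ?g \<omega>)"
      by (simp add: inner_diff_right)
    then show "?g \<omega> \<bullet> (ghat t levels \<omega> - ?g \<omega>) = ?g \<omega> \<bullet> ?e \<omega> + (\<Sum>p\<in>?P. ?c * ?N p \<omega>)"
      unfolding gmean_noise inner_sum_right by simp
  qed
  also have "\<dots> = (\<integral>\<omega>. ?g \<omega> \<bullet> ?e \<omega> \<partial>M) + (\<Sum>p\<in>?P. ?c * (\<integral>\<omega>. ?N p \<omega> \<partial>M))"
    using e n(1) by (subst Bochner_Integration.integral_add)
      (auto simp: Bochner_Integration.integral_sum intro!: Bochner_Integration.integrable_sum)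
  also have "\<dots> = (\<integral>\<omega>. ?g \<omega> \<bullet> ?e \<omega> \<partial>M)"
    using n(2) by (simp del: sum_constant)
  finally have "- 2 * ?r levels = (\<integral>\<omega>. - 2 * (?g \<omega> \<bullet> ?e \<omega>) \<partial>M)" by simp
  also have "\<dots> \<le> (\<integral>\<omega>. (norm (?g \<omega>))\<^sup>2 + (norm (?e \<omega>))\<^sup>2 \<partial>M)"
  proof (rule integral_mono)
    show "integrable M (\<lambda>\<omega>. - 2 * (?g \<omega> \<bullet> ?e \<omega>))" using e by (rule integrable_mult_right)
    show "integrable M (\<lambda>\<omega>. (norm (?g \<omega>))\<^sup>2 + (norm (?e \<omega>))\<^sup>2)"
      using sq aggregation_error(1)[OF t X] by simp
    show "- 2 * (?g \<omega> \<bullet> ?e \<omega>) \<le> (norm (?g \<omega>))\<^sup>2 + (norm (?e \<omega>))\<^sup>2" for \<omega>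
      using abs_inner_le_half_squares[of "?g \<omega>" "?e \<omega>"] by (simp add: abs_le_iff)
  qed
  also have "\<dots> = (\<integral>\<omega>. (norm (?g \<omega>))\<^sup>2 \<partial>M) + (\<integral>\<omega>. (norm (?e \<omega>))\<^sup>2 \<partial>M)"
    using sq aggregation_error(1)[OF t X] by simp
  also have "\<dots> \<le> (\<integral>\<omega>. (norm (?g \<omega>))\<^sup>2 \<partial>M) + \<kappa> * \<sigma>\<^sup>2 / 2^levels"
    using aggregation_error(2)[OF t X] by simp
  finally show "- 2 * (\<integral>\<omega>. ?g \<omega> \<bullet> (gt t \<omega> - ?g \<omega>) \<partial>M)
      \<le> (\<integral>\<omega>. (norm (?g \<omega>))\<^sup>2 \<partial>M) + \<kappa> * \<sigma>\<^sup>2 / 2^levels"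
    unfolding eq .
qed

subsection \<open>Descent\<close>

lemma next_iterate: "\<omega> \<in> space M \<Longrightarrow> x (Suc t) \<omega> = x t \<omega> - \<eta> *\<^sub>R gt t \<omega>"
  using x_step[OF t] by (simp add: gt_def)

lemma next_iterate_measurable: "x (Suc t) \<in> borel_measurable (\<F> t)"
proof -
  have tT: "t \<le> T" using t by simp
  have sp: "space (\<F> t) = space M"
    using F_subalgebra[OF tT] by (simp add: subalgebra_def)
  note [measurable] = gt_measurable
    measurable_from_subalg[OF H_sub_F[OF t] measurable_from_subalg[OF F_sub_H[OF t] X]]
  have "x (Suc t) \<in> borel_measurable (\<F> t) \<longleftrightarrow> (\<lambda>\<omega>. x t \<omega> - \<eta> *\<^sub>R gt t \<omega>) \<in> borel_measurable (\<F> t)"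
    by (rule measurable_cong) (simp add: sp next_iterate)
  then show ?thesis by simp
qed

lemma grad_square_integrable:
  assumes "integrable M (\<lambda>\<omega>. f (x t \<omega>))"
  shows "integrable M (\<lambda>\<omega>. (norm (grad f (x t \<omega>)))\<^sup>2)"
    and "(\<integral>\<omega>. (norm (grad f (x t \<omega>)))\<^sup>2 \<partial>M) \<le> 2 * L * ((\<integral>\<omega>. f (x t \<omega>) \<partial>M) - fmin)"
proof -
  have pt: "(norm (grad f (x t \<omega>)))\<^sup>2 \<le> 2 * L * (f (x t \<omega>) - fmin)" for \<omega>
    unfolding fmin_def by (rule L_smooth_grad_bound[OF L_pos smooth f_bdd])
  have int: "integrable M (\<lambda>\<omega>. 2 * L * (f (x t \<omega>) - fmin))" using assms by simp
  show I: "integrable M (\<lambda>\<omega>. (norm (grad f (x t \<omega>)))\<^sup>2)"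
    by (rule integrable_of_nonneg_le[OF int]) (use pt in simp_all)
  show "(\<integral>\<omega>. (norm (grad f (x t \<omega>)))\<^sup>2 \<partial>M) \<le> 2 * L * ((\<integral>\<omega>. f (x t \<omega>) \<partial>M) - fmin)"
    using integral_mono[OF I int pt] assms by (simp add: prob_space)
qed

lemma descent:
  assumes int: "integrable M (\<lambda>\<omega>. f (x t \<omega>))"
  shows "integrable M (\<lambda>\<omega>. f (x (Suc t) \<omega>))"
    and "(\<integral>\<omega>. f (x (Suc t) \<omega>) \<partial>M) \<le> (\<integral>\<omega>. f (x t \<omega>) \<partial>M)
      - \<eta> / 2 * (\<integral>\<omega>. (norm (grad f (x t \<omega>)))\<^sup>2 \<partial>M)
      + \<eta> / 2 * (\<kappa> * \<sigma>\<^sup>2 / 2^levels) + L * \<eta>\<^sup>2 / 2 * noise_bound"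
proof -
  let ?g = "\<lambda>\<omega>. grad f (x t \<omega>)"
  let ?w = "\<lambda>\<omega>. gt t \<omega> - ?g \<omega>"
  let ?R = "\<lambda>\<omega>. f (x t \<omega>) - (\<eta> - L * \<eta>\<^sup>2 / 2) * (norm (?g \<omega>))\<^sup>2
    - \<eta> * (1 - L * \<eta>) * (?g \<omega> \<bullet> ?w \<omega>) + L * \<eta>\<^sup>2 / 2 * (norm (?w \<omega>))\<^sup>2"
  note sq = grad_square_integrable(1)[OF int]
  note B = gt_bias[OF sq] and V = gt_error
  have pt: "f (x (Suc t) \<omega>) \<le> ?R \<omega>" if "\<omega> \<in> space M" for \<omega>
  proof -
    have "f (x (Suc t) \<omega>) \<le> f (x t \<omega>) + ?g \<omega> \<bullet> (x (Suc t) \<omega> - x t \<omega>)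
        + L / 2 * (norm (x (Suc t) \<omega> - x t \<omega>))\<^sup>2"
      using smooth unfolding L_smooth_def by blast
    also have "x (Suc t) \<omega> - x t \<omega> = - \<eta> *\<^sub>R (?g \<omega> + ?w \<omega>)"
      using next_iterate[OF that] by simp
    also have "f (x t \<omega>) + ?g \<omega> \<bullet> (- \<eta> *\<^sub>R (?g \<omega> + ?w \<omega>)) + L / 2 * (norm (- \<eta> *\<^sub>R (?g \<omega> + ?w \<omega>)))\<^sup>2 = ?R \<omega>"
      using quadratic_step[of "?g \<omega>" \<eta> "?w \<omega>" L] by linarith
    finally show ?thesis .
  qed
  have intR: "integrable M ?R"
    using int sq B(1) V(1) by (intro Bochner_Integration.integrable_add
        Bochner_Integration.integrable_diff integrable_mult_right) auto
  have low: "fmin \<le> f y" for y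
    unfolding fmin_def using f_bdd by (intro cINF_lower) auto
  have [measurable]: "x (Suc t) \<in> borel_measurable M"
    using t by (intro measurable_from_subalg[OF F_subalgebra next_iterate_measurable]) auto
  \<comment> \<open>The pointwise estimate bounds from above only; subtracting \<open>fmin\<close>
    makes the function nonnegative, so that domination applies.\<close>
  have "integrable M (\<lambda>\<omega>. f (x (Suc t) \<omega>) - fmin)"
  proof (rule integrable_of_nonneg_le)
    show "integrable M (\<lambda>\<omega>. ?R \<omega> - fmin)"
      by (rule Bochner_Integration.integrable_diff[OF intR integrable_const])
    show "f (x (Suc t) \<omega>) - fmin \<le> ?R \<omega> - fmin" if "\<omega> \<in> space M" for \<omega>
      by (rule diff_right_mono[OF pt[OF that]])
  qed (use low in simp_all)
  from Bochner_Integration.integrable_add[OF this integrable_const[of fmin]]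
  show intS: "integrable M (\<lambda>\<omega>. f (x (Suc t) \<omega>))" by simp
  let ?Q = "\<integral>\<omega>. (norm (?g \<omega>))\<^sup>2 \<partial>M" and ?I = "\<integral>\<omega>. ?g \<omega> \<bullet> ?w \<omega> \<partial>M"
    and ?W = "\<integral>\<omega>. (norm (?w \<omega>))\<^sup>2 \<partial>M"
  have "(\<integral>\<omega>. f (x (Suc t) \<omega>) \<partial>M) \<le> (\<integral>\<omega>. ?R \<omega> \<partial>M)"
    by (rule integral_mono[OF intS intR pt])
  also have "\<dots> = (\<integral>\<omega>. f (x t \<omega>) \<partial>M) - (\<eta> - L * \<eta>\<^sup>2 / 2) * ?Q - \<eta> * (1 - L * \<eta>) * ?I
      + L * \<eta>\<^sup>2 / 2 * ?W"
    using int sq B(1) V(1) by simp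
  also have "\<dots> \<le> (\<integral>\<omega>. f (x t \<omega>) \<partial>M) - \<eta> / 2 * ?Q + \<eta> / 2 * (\<kappa> * \<sigma>\<^sup>2 / 2^levels)
      + L * \<eta>\<^sup>2 / 2 * noise_bound"
    using eta_nonneg eta_le L_pos kappa_nonneg B(2) V(2)
    by (intro descent_arith) (auto simp: field_simps)
  finally show "(\<integral>\<omega>. f (x (Suc t) \<omega>) \<partial>M) \<le> (\<integral>\<omega>. f (x t \<omega>) \<partial>M) - \<eta> / 2 * ?Q
      + \<eta> / 2 * (\<kappa> * \<sigma>\<^sup>2 / 2^levels) + L * \<eta>\<^sup>2 / 2 * noise_bound" .
qed

end

text \<open>
  Outside their context, these rules have the measurability of \<open>x t\<close> as a premise, on which the
  measurability prover loops.
\<close>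
declare rv [measurable del] gt_rv [measurable del]

section \<open>Summation over the rounds and the choice of the step size\<close>

definition round_cost :: real where
  "round_cost = \<eta> / 2 * (\<kappa> * \<sigma>\<^sup>2 / 2^levels) + L * \<eta>\<^sup>2 / 2 * noise_bound"

text \<open>Measurability and integrability are part of the induction because the estimates of each
  round presuppose them. The index is shifted: \<open>x (Suc n)\<close> is known after round
  \<open>n\<close>.\<close>

lemma iterates:
  assumes "n \<le> T"
  shows "x (Suc n) \<in> borel_measurable (\<F> n) \<and> integrable M (\<lambda>\<omega>. f (x (Suc n) \<omega>)) \<and>
    (\<integral>\<omega>. f (x (Suc n) \<omega>) \<partial>M) + \<eta> / 2 * (\<Sum>t=1..n. \<integral>\<omega>. (norm (grad f (x t \<omega>)))\<^sup>2 \<partial>M)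
      \<le> f x1 + real n * round_cost"
  using assms
proof (induction n)
  case 0
  have sp: "space (\<F> 0) = space M"
    using F_subalgebra[of 0] by (simp add: subalgebra_def)
  have x0: "x (Suc 0) \<omega> = x1" if "\<omega> \<in> space M" for \<omega>
    using x_init[OF that] by simp
  have "x (Suc 0) \<in> borel_measurable (\<F> 0)"
    by (subst measurable_cong[of _ _ "\<lambda>_. x1"]) (simp_all only: sp x0 measurable_const space_borel UNIV_I)
  moreover have "integrable M (\<lambda>\<omega>. f (x (Suc 0) \<omega>))"
    by (subst Bochner_Integration.integrable_cong[of M M _ "\<lambda>_. f x1"])
       (simp_all only: x0 integrable_const)
  moreover have "(\<integral>\<omega>. f (x (Suc 0) \<omega>) \<partial>M) = (\<integral>\<omega>. f x1 \<partial>M)"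
    by (rule Bochner_Integration.integral_cong) (simp_all only: x0)
  then have "(\<integral>\<omega>. f (x (Suc 0) \<omega>) \<partial>M) = f x1"
    by (simp only: lebesgue_integral_const prob_space scaleR_one)
  ultimately show ?case by simp
next
  case (Suc n)
  then have IH: "x (Suc n) \<in> borel_measurable (\<F> n)" "integrable M (\<lambda>\<omega>. f (x (Suc n) \<omega>))"
    "(\<integral>\<omega>. f (x (Suc n) \<omega>) \<partial>M) + \<eta> / 2 * (\<Sum>t=1..n. \<integral>\<omega>. (norm (grad f (x t \<omega>)))\<^sup>2 \<partial>M)
      \<le> f x1 + real n * round_cost"
    by auto
  have t: "Suc n \<in> {1..T}" using Suc.prems by simp
  have X: "x (Suc n) \<in> borel_measurable (\<F> (Suc n - 1))" using IH(1) by simp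
  have "(\<integral>\<omega>. f (x (Suc (Suc n)) \<omega>) \<partial>M)
      + \<eta> / 2 * (\<Sum>t=1..Suc n. \<integral>\<omega>. (norm (grad f (x t \<omega>)))\<^sup>2 \<partial>M)
      = (\<integral>\<omega>. f (x (Suc (Suc n)) \<omega>) \<partial>M) + \<eta> / 2 * (\<Sum>t=1..n. \<integral>\<omega>. (norm (grad f (x t \<omega>)))\<^sup>2 \<partial>M)
        + \<eta> / 2 * (\<integral>\<omega>. (norm (grad f (x (Suc n) \<omega>)))\<^sup>2 \<partial>M)"
    by (simp add: distrib_left)
  also have "\<dots> \<le> f x1 + real n * round_cost + round_cost"
    using descent(2)[OF t X IH(2)] IH(3) unfolding round_cost_def by linarith
  also have "\<dots> = f x1 + real (Suc n) * round_cost"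
    by (simp add: distrib_right)
  finally show ?case
    using next_iterate_measurable[OF t X] descent(1)[OF t X IH(2)] by blast
qed

lemma iterate_measurable: "t \<in> {1..T} \<Longrightarrow> x t \<in> borel_measurable (\<F> (t - 1))"
  using iterates[of "t - 1"] by auto

lemma iterate_integrable: "t \<in> {1..T} \<Longrightarrow> integrable M (\<lambda>\<omega>. f (x t \<omega>))"
  using iterates[of "t - 1"] by auto

lemmas grad_square = grad_square_integrable[OF _ iterate_measurable iterate_integrable]

lemma sum_grad_square_le:
  "\<eta> * (\<Sum>t=1..T. \<integral>\<omega>. (norm (grad f (x t \<omega>)))\<^sup>2 \<partial>M) \<le> 2 * (f x1 - fmin) + 2 * real T * round_cost"
proof -
  have T: "T \<le> T" by simp
  have low: "fmin \<le> f y" for y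
    unfolding fmin_def using f_bdd by (intro cINF_lower) auto
  have "(\<integral>\<omega>. fmin \<partial>M) \<le> (\<integral>\<omega>. f (x (Suc T) \<omega>) \<partial>M)"
    using iterates[OF T] low by (intro integral_mono) auto
  then show ?thesis
    using iterates[OF T] by (simp add: prob_space)
qed

text \<open>A bound for single gradients that involves no division by \<eta>. It serves the cases T
  = 1, where only the initial gap may count, and \<Delta> = 0, where \<eta> may vanish.\<close>

lemma grad_square_le:
  assumes "t \<in> {1..T}"
  shows "(\<integral>\<omega>. (norm (grad f (x t \<omega>)))\<^sup>2 \<partial>M) \<le> 2 * L * (f x1 - fmin + real (t - 1) * round_cost)"
proof -
  let ?S = "\<Sum>s=1..t - 1. \<integral>\<omega>. (norm (grad f (x s \<omega>)))\<^sup>2 \<partial>M"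
  have "0 \<le> \<eta> / 2 * ?S"
    using eta_nonneg by (intro mult_nonneg_nonneg sum_nonneg integral_nonneg) auto
  moreover have "(\<integral>\<omega>. f (x t \<omega>) \<partial>M) + \<eta> / 2 * ?S \<le> f x1 + real (t - 1) * round_cost"
    using iterates[of "t - 1"] assms by auto
  ultimately have "(\<integral>\<omega>. f (x t \<omega>) \<partial>M) - fmin \<le> f x1 - fmin + real (t - 1) * round_cost"
    by linarith
  then have "2 * L * ((\<integral>\<omega>. f (x t \<omega>) \<partial>M) - fmin) \<le> 2 * L * (f x1 - fmin + real (t - 1) * round_cost)"
    using L_pos by (intro mult_left_mono) auto
  with grad_square(2)[OF assms assms assms] show ?thesis by linarith
qed

text \<open>The floor loses less than one in the exponent, so the top level averages at least T/2
  samples and its squared bias is of order 1/T.\<close>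

lemma two_power_levels: "real T \<le> 2 * 2^levels" "real levels \<le> log 2 (real T)"
proof -
  have T: "0 < real T" "0 \<le> log 2 (real T)" using T_ge_1 by auto
  then have lev: "real levels = of_int \<lfloor>log 2 (real T)\<rfloor>"
    by (simp add: levels_def zero_le_floor)
  show "real levels \<le> log 2 (real T)" unfolding lev by (rule of_int_floor_le)
  have "log 2 (real T) \<le> real (Suc levels)" using lev by simp linarith
  then have "real T \<le> 2 powr real (Suc levels)"
    using T by (simp add: log_le_iff)
  also have "\<dots> = 2^Suc levels" by (rule powr_realpow) simp
  finally show "real T \<le> 2 * 2^levels" by simp
qed

lemma round_cost_le:
  "2 * round_cost \<le> \<eta> * (2 * gamma * \<sigma>\<^sup>2 / real T) + L * \<eta>\<^sup>2 * ((8 + 18 * log 2 (real T)) * gamma * \<sigma>\<^sup>2)"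
proof -
  have "\<kappa> * \<sigma>\<^sup>2 / 2^levels \<le> \<kappa> * \<sigma>\<^sup>2 * (2 / real T)"
    using two_power_levels(1) T_ge_1 kappa_nonneg
    by (subst divide_inverse, intro mult_left_mono) (auto simp: field_simps)
  also have "\<dots> \<le> gamma * \<sigma>\<^sup>2 * (2 / real T)"
    using kappa_le_gamma by (intro mult_right_mono) auto
  finally have "\<eta> * (\<kappa> * \<sigma>\<^sup>2 / 2^levels) \<le> \<eta> * (2 * gamma * \<sigma>\<^sup>2 / real T)"
    using eta_nonneg by (intro mult_left_mono) (auto simp: mult_ac)
  moreover have "noise_bound \<le> (8 + 18 * log 2 (real T)) * gamma * \<sigma>\<^sup>2"
    unfolding noise_bound_def using two_power_levels(2) gamma_pos
    by (intro mult_right_mono) auto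
  then have "L * \<eta>\<^sup>2 * noise_bound \<le> L * \<eta>\<^sup>2 * ((8 + 18 * log 2 (real T)) * gamma * \<sigma>\<^sup>2)"
    using L_pos by (intro mult_left_mono) auto
  ultimately show ?thesis unfolding round_cost_def by simp
qed

lemma average_bound:
  assumes \<eta>: "\<eta> = learning_rate L \<sigma> gamma (f x1 - fmin) T" and "0 \<le> \<sigma>"
  shows "1 / real T * (\<Sum>t=1..T. \<integral>\<omega>. (norm (grad f (x t \<omega>)))\<^sup>2 \<partial>M)
    \<le> 16 * sqrt (L * (f x1 - fmin) * \<sigma>\<^sup>2 * gamma * log 2 (real T) / real T)
      + 2 * (L * (f x1 - fmin) + 2 * \<sigma>\<^sup>2 * gamma) / real T"
    (is "1 / real T * ?S \<le> 16 * sqrt ?q + ?b")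
proof -
  define \<Delta> where "\<Delta> = f x1 - fmin"
  have \<Delta>: "0 \<le> \<Delta>"
    unfolding \<Delta>_def fmin_def using f_bdd by (simp add: cINF_lower)
  have lg: "0 \<le> log 2 (real T)" using T_ge_1 by simp
  have q: "0 \<le> 16 * sqrt ?q" using \<Delta> lg L_pos gamma_pos by (simp add: \<Delta>_def)
  \<comment> \<open>In the cases \<open>one\<close> and \<open>exact\<close> this part of the
    right-hand side suffices.\<close>
  have "2 * L * \<Delta> / real T \<le> ?b"
    using gamma_pos by (intro divide_right_mono) (auto simp: \<Delta>_def)
  with q have le: "2 * L * \<Delta> / real T \<le> 16 * sqrt ?q + ?b" by linarith
  moreover have "0 \<le> 2 * L * \<Delta> / real T" using \<Delta> L_pos by simp
  ultimately have nonneg: "0 \<le> 16 * sqrt ?q + ?b" by linarith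
  consider (one) "T = 1" | (exact) "\<sigma> = 0" | (optimal) "T \<noteq> 1" "\<sigma> \<noteq> 0" "\<Delta> = 0"
    | (general) "T \<noteq> 1" "\<sigma> \<noteq> 0" "\<Delta> \<noteq> 0"
    by blast
  then show ?thesis
  proof cases
    \<comment> \<open>The only iterate is the deterministic starting point, so no noise has entered
      yet.\<close>
    case one
    then have "?S \<le> 2 * L * \<Delta>"
      using grad_square_le[of 1] by (simp add: \<Delta>_def)
    then have "1 / real T * ?S \<le> 2 * L * \<Delta> / real T" using one by simp
    from this le show ?thesis by (rule order_trans)
  next
    \<comment> \<open>Without noise the cost of a round is zero, and the summed descent with \<eta>
      = 1/L is enough.\<close>
    case exact
    then have "\<eta> = 1 / L" by (simp add: \<eta> learning_rate_def)
    moreover have "round_cost = 0" unfolding round_cost_def noise_bound_def using exact by simp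
    ultimately have "?S / L \<le> 2 * \<Delta>" using sum_grad_square_le by (simp add: \<Delta>_def)
    then have "?S \<le> 2 * L * \<Delta>" using L_pos by (simp add: field_simps)
    then have "1 / real T * ?S \<le> 2 * L * \<Delta> / real T" by (simp add: divide_right_mono)
    from this le show ?thesis by (rule order_trans)
  next
    \<comment> \<open>The start is a minimizer and \<eta> = 0, so nothing can be divided by \<eta>;
      every single gradient vanishes in mean square instead.\<close>
    case optimal
    have "0 < log 2 (real T)" using optimal T_ge_1 by simp
    then have "log 2 (real T) \<noteq> 0" by linarith
    then have "\<eta> = 0"
      using optimal T_ge_1 L_pos gamma_pos by (simp add: \<eta> learning_rate_def \<Delta>_def Let_def)
    then have "round_cost = 0" unfolding round_cost_def by simp
    then have "?S \<le> (\<Sum>t=1..T. 0)"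
      using grad_square_le optimal by (intro sum_mono) (fastforce simp: \<Delta>_def)
    then have "1 / real T * ?S \<le> 0" by (simp add: divide_nonpos_nonneg)
    from this nonneg show ?thesis by (rule order_trans)
  next
    \<comment> \<open>T \<ge> 2 gives log T \<ge> 1, which lets the constant 8 be absorbed into the
      logarithmic term.\<close>
    case general
    then have T2: "2 \<le> real T" using T_ge_1 by simp
    then have l: "1 \<le> log 2 (real T)" by (simp add: le_log_iff)
    then have "log 2 (real T) \<noteq> 0" by linarith
    then have "4 * \<sigma> * sqrt (L * gamma * real T * log 2 (real T)) \<noteq> 0"
      using general L_pos gamma_pos T2 by simp
    then have rate: "\<eta> = min (sqrt \<Delta> / (4 * \<sigma> * sqrt (L * gamma * real T * log 2 (real T)))) (1 / L)"
      by (simp add: \<eta> learning_rate_def \<Delta>_def Let_def)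
    have "\<eta> * ?S \<le> 2 * \<Delta> + real T * (\<eta> * (2 * gamma * \<sigma>\<^sup>2 / real T)
        + L * \<eta>\<^sup>2 * ((8 + 18 * log 2 (real T)) * gamma * \<sigma>\<^sup>2))"
      using sum_grad_square_le mult_left_mono[OF round_cost_le, of "real T"]
      by (simp add: \<Delta>_def mult.assoc[symmetric] mult.commute[of 2])
    then have "?S / real T \<le> 16 * sqrt (L * \<Delta> * \<sigma>\<^sup>2 * gamma * log 2 (real T) / real T)
        + 2 * (L * \<Delta> + 2 * \<sigma>\<^sup>2 * gamma) / real T"
      using general \<Delta> L_pos gamma_pos T2 \<open>0 \<le> \<sigma>\<close>
      by (intro learning_rate_tradeoff[OF _ _ _ _ _ l rate]) auto
    then show ?thesis by (simp add: \<Delta>_def)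
  qed
qed

end

lemma learning_rate_bounds:
  assumes "0 < L" "0 \<le> \<sigma>" "0 \<le> \<gamma>" "0 \<le> \<Delta>" "1 \<le> T"
  shows "0 \<le> learning_rate L \<sigma> \<gamma> \<Delta> T" "learning_rate L \<sigma> \<gamma> \<Delta> T \<le> 1 / L"
  using assms by (auto simp: learning_rate_def Let_def)

theorem theorem3p4:
  fixes M :: "'o measure"
    and D :: "'z measure"
    and F :: "real^'d \<Rightarrow> 'z \<Rightarrow> real"
    and f :: "real^'d \<Rightarrow> real"
    and A :: "(real^'d)^'w::finite \<Rightarrow> real^'d"
    and G :: "'w set"
    and K :: "(real^'d) set"
    and \<xi> :: "nat \<Rightarrow> 'w \<Rightarrow> nat \<Rightarrow> 'o \<Rightarrow> 'z"
    and b :: "nat \<Rightarrow> 'w \<Rightarrow> nat \<Rightarrow> 'o \<Rightarrow> real^'d"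
    and J :: "nat \<Rightarrow> 'o \<Rightarrow> nat"
    and \<F> \<H> :: "nat \<Rightarrow> 'o measure"
    and x :: "nat \<Rightarrow> 'o \<Rightarrow> real^'d"
    and x1 :: "real^'d"
    and T :: nat
    and L \<sigma> \<delta> \<kappa> \<gamma> \<Delta> \<eta> :: real
  assumes "prob_space D"
    and "\<And>y z. z \<in> space D \<Longrightarrow> (\<lambda>u. F u z) differentiable (at y)"
    and "\<And>y. integrable D (F y)"
    and "\<And>y. f y = (\<integral>z. F y z \<partial>D)"
    and "0 < L" and "L_smooth L f"
    and "bdd_below (range f)"
    and "\<And>y. integrable D (\<lambda>z. grad (\<lambda>u. F u z) y)"
    and "\<And>y. (\<integral>z. grad (\<lambda>u. F u z) y \<partial>D) = grad f y"
    and "0 \<le> \<sigma>"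
    and "\<And>y. integrable D (\<lambda>z. (norm (grad (\<lambda>u. F u z) y - grad f y))\<^sup>2)"
    and "\<And>y. (\<integral>z. (norm (grad (\<lambda>u. F u z) y - grad f y))\<^sup>2 \<partial>D) \<le> \<sigma>\<^sup>2"
    and "\<delta> < 1/2" and "real (card G) = (1 - \<delta>) * real CARD('w)"
    and "robust_aggregator \<delta> \<kappa> A" and "A \<in> borel_measurable borel"
    and "byzantine_rounds M D G T \<xi> b J \<F> \<H>"
    and "1 \<le> T"
    and "\<gamma> = \<kappa> + 1 / real CARD('w)"
    and "\<Delta> = f x1 - (INF y. f y)"
    and "\<eta> = learning_rate L \<sigma> \<gamma> \<Delta> T"
    and "K = UNIV"
    and "\<And>\<omega>. \<omega> \<in> space M \<Longrightarrow> x 1 \<omega> = x1"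
    and "\<And>t \<omega>. \<lbrakk>t \<in> {1..T}; \<omega> \<in> space M\<rbrakk> \<Longrightarrow>
           x (Suc t) \<omega> = closest_point K (x t \<omega> - \<eta> *\<^sub>R
             mlmc_gradient F A G T (J t \<omega>) (\<lambda>i k. \<xi> t i k \<omega>) (\<lambda>i j. b t i j \<omega>) (x t \<omega>))"
  shows "(\<forall>t\<in>{1..T}. integrable M (\<lambda>\<omega>. (norm (grad f (x t \<omega>)))\<^sup>2)) \<and>
         1 / real T * (\<Sum>t=1..T. \<integral>\<omega>. (norm (grad f (x t \<omega>)))\<^sup>2 \<partial>M)
           \<le> 16 * sqrt (L * \<Delta> * \<sigma>\<^sup>2 * \<gamma> * log 2 (real T) / real T)
             + 2 * (L * \<Delta> + 2 * \<sigma>\<^sup>2 * \<gamma>) / real T"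
proof -
  have \<gamma>: "0 \<le> \<gamma>"
    using assms(15,19) by (simp add: robust_aggregator_def)
  have \<Delta>: "0 \<le> \<Delta>"
    using assms(7,20) by (simp add: cINF_lower)
  note \<eta> = learning_rate_bounds[OF assms(5,10) \<gamma> \<Delta> assms(18), folded assms(21)]
  interpret rounds: byzantine_rounds M D G T \<xi> b J \<F> \<H> by fact
  interpret D: prob_space D by fact
  interpret byzantine_sgd M D G T \<xi> b J \<F> \<H> F f A x x1 L \<sigma> \<delta> \<kappa> \<eta>
  proof unfold_locales
    show "x (Suc t) \<omega> = x t \<omega> - \<eta> *\<^sub>R
        mlmc_gradient F A G T (J t \<omega>) (\<lambda>i k. \<xi> t i k \<omega>) (\<lambda>i j. b t i j \<omega>) (x t \<omega>)"
      if "t \<in> {1..T}" "\<omega> \<in> space M" for t \<omega>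
      \<comment> \<open>Projection onto the whole space is the identity.\<close>
      using assms(24)[OF that] by (simp add: assms(22) closest_point_self)
  qed (use assms \<eta> in auto)
  have "gamma = \<gamma>" "\<Delta> = f x1 - fmin"
    using assms(19,20) by (auto simp: gamma_def fmin_def)
  then show ?thesis
    using grad_square(1) average_bound assms(10,21) by simp
qed

end
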